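(* Let $d \geq 2$ and let $Y \subset \Gamma^{\mathbb{Z}^d}$ be a countably covered vertically constant sofic shift over a finite alphabet $\Gamma$. Then $Y$ satisfies the countable cover conditions.
   Context: For a finite alphabet $\Sigma$ and $d \geq 1$, $\Sigma^{\mathbb{Z}^d}$ carries the product topology and its elements are called configurations; $\mathbb{Z}^d$ acts by $\sigma^{\vec v}(x)_{\vec w} = x_{\vec v + \vec w}$. A shift space is a closed, shift-invariant subset of $\Sigma^{\mathbb{Z}^d}$; equivalently, the set of configurations in which no pattern from some set of forbidden finite patterns occurs. It is a shift of finite type (SFT) if the set of forbidden patterns can be chosen finite, and effectively closed if it can be chosen computably enumerable (equivalently, the set of all finite patterns not occurring in the shift space is computably enumerable). A block code is a continuous map between two $\mathbb{Z}^d$-shift spaces that commutes with the shift actions. A sofic shift is the image of an SFT under a block code; the SFT and the block code form an SFT cover of the image. A sofic shift is countably covered if it has an SFT cover whose SFT has countably many configurations. A configuration $x \in \Sigma^{\mathbb{Z}^d}$ is vertically constant if $\sigma^{\vec e_i}(x) = x$ for each standard basis vector $\vec e_2, \ldots, \vec e_d$; a shift space is vertically constant if all its configurations are. The projective subdynamics $P(Y) \subset \Gamma^{\mathbb{Z}}$ of $Y \subset \Gamma^{\mathbb{Z}^d}$ is the set of restrictions of configurations of $Y$ to the row $\mathbb{Z} \times \{0\}^{d-1}$, identified with $\mathbb{Z}$. A configuration $y \in \Gamma^{\mathbb{Z}}$ is ultimately periodic to the right if there is $p > 0$ with $y_n = y_{n+p}$ for all large enough $n$; ultimate periodicity to the left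 is defined analogously. $\Gamma^+$ is the set of nonempty finite words over $\Gamma$, and ${}^\infty u v w^\infty$ is the bi-infinite configuration $\cdots u u v w w \cdots$ (membership in a shift space does not depend on the choice of origin). Countable cover conditions: a one-dimensional shift space $Y \subset \Gamma^{\mathbb{Z}}$ satisfies the countable cover conditions if (1) $Y$ is effectively closed, (2) every $y \in Y$ is ultimately periodic to the left and right, and (3) given $u, v, w \in \Gamma^+$, it is decidable whether ${}^\infty u v w^\infty \in Y$. A $d$-dimensional shift space $Y \subset \Gamma^{\mathbb{Z}^d}$ satisfies the countable cover conditions if it is vertically constant and $P(Y)$ satisfies the one-dimensional conditions. *)

theory Defs
  imports "HOL-Analysis.Analysis" "HOL-Library.Nat_Bijection"
begin

section \<open>Partial recursive functions\<close>

datatype recf =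
    Zero
  | Succ
  | Proj nat
  | Comp recf "recf list"
  | PrimRec recf recf
  | Mu recf

text \<open>\<open>rec_eval r xs y\<close>: the partial recursive function with program \<open>r\<close> is defined at the
  argument tuple \<open>xs\<close> and has the value \<open>y\<close> there.\<close>

inductive rec_eval :: "recf \<Rightarrow> nat list \<Rightarrow> nat \<Rightarrow> bool" where
  zero: "rec_eval Zero xs 0"
| succ: "rec_eval Succ [x] (Suc x)"
| proj: "i < length xs \<Longrightarrow> rec_eval (Proj i) xs (xs ! i)"
| comp: "\<lbrakk>list_all2 (\<lambda>g y. rec_eval g xs y) gs ys; rec_eval f ys z\<rbrakk> \<Longrightarrow> rec_eval (Comp f gs) xs z"
| primrec_0: "rec_eval f xs y \<Longrightarrow> rec_eval (PrimRec f g) (0 # xs) y"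
| primrec_Suc: "\<lbrakk>rec_eval (PrimRec f g) (n # xs) y; rec_eval g (n # y # xs) z\<rbrakk>
    \<Longrightarrow> rec_eval (PrimRec f g) (Suc n # xs) z"
| mu: "\<lbrakk>\<forall>m<n. \<exists>y>0. rec_eval f (m # xs) y; rec_eval f (n # xs) 0\<rbrakk> \<Longrightarrow> rec_eval (Mu f) xs n"

inductive_cases rec_evalE:
  "rec_eval Zero xs y"
  "rec_eval Succ xs y"
  "rec_eval (Proj i) xs y"
  "rec_eval (Comp f gs) xs y"
  "rec_eval (PrimRec f g) (0 # xs) y"
  "rec_eval (PrimRec f g) (Suc n # xs) y"
  "rec_eval (Mu f) xs y"

lemma rec_eval_deterministic:
  "rec_eval r xs y \<Longrightarrow> rec_eval r xs y' \<Longrightarrow> y = y'"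
proof (induction arbitrary: y' rule: rec_eval.induct)
  case (zero xs)
  from zero.prems show ?case by (rule rec_evalE(1)) simp
next
  case (succ x)
  then show ?case by (elim rec_evalE(2)) simp
next
  case (proj i xs)
  then show ?case by (elim rec_evalE(3)) simp
next
  case (comp xs gs ys f z)
  from comp.prems obtain ys' where ys': "list_all2 (\<lambda>g y. rec_eval g xs y) gs ys'"
      and z: "rec_eval f ys' y'"
    by (rule rec_evalE(4))
  have "length ys = length gs" "length ys' = length gs"
    using list_all2_lengthD[OF comp.IH(1)] list_all2_lengthD[OF ys'] by simp_all
  moreover have "ys ! i = ys' ! i" if "i < length gs" for i
    using list_all2_nthD[OF comp.IH(1) that] list_all2_nthD[OF ys' that] by blast
  ultimately have "length ys = length ys'" "\<And>i. i < length ys \<Longrightarrow> ys ! i = ys' ! i"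
    by simp_all
  then have "ys = ys'" by (rule nth_equalityI)
  then show ?case using comp.IH(2) z by blast
next
  case (primrec_0 f xs y g)
  from primrec_0.prems have "rec_eval f xs y'" by (rule rec_evalE(5))
  then show ?case by (rule primrec_0.IH)
next
  case (primrec_Suc f g n xs y z)
  from primrec_Suc.prems obtain u where u: "rec_eval (PrimRec f g) (n # xs) u"
      and z: "rec_eval g (n # u # xs) y'"
    by (rule rec_evalE(6))
  from u have "y = u" by (rule primrec_Suc.IH(1))
  then show ?case using z primrec_Suc.IH(2) by simp
next
  case (mu n f xs)
  from mu.prems have lt: "\<forall>m<y'. \<exists>y>0. rec_eval f (m # xs) y" and eq: "rec_eval f (y' # xs) 0"
    by - (erule rec_evalE(7), assumption)+
  show ?case
  proof (rule linorder_cases[of n y'])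
    assume "n < y'"
    then obtain y where "y > 0" "rec_eval f (n # xs) y" using lt by blast
    then show ?thesis using mu.IH(2)[of y] by simp
  next
    assume "y' < n"
    then obtain y where "y > 0" "\<And>z. rec_eval f (y' # xs) z \<Longrightarrow> y = z" using mu.IH(1) by blast
    then show ?thesis using eq by blast
  qed
qed

definition computably_enumerable :: "nat set \<Rightarrow> bool" where
  "computably_enumerable A \<longleftrightarrow> (\<exists>r. \<forall>n. n \<in> A \<longleftrightarrow> (\<exists>y. rec_eval r [n] y))"

text \<open>Decidability of a \<open>k\<close>-ary relation on natural numbers, given as a set of lists of length
  \<open>k\<close>.\<close>

definition decidable_relation :: "nat \<Rightarrow> nat list set \<Rightarrow> bool" where
  "decidable_relation k R \<longleftrightarrow>
     (\<exists>r. \<forall>xs. length xs = k \<longrightarrow> rec_eval r xs (if xs \<in> R then 1 else 0))"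

section \<open>Shift spaces\<close>

text \<open>Configurations are functions \<open>'g \<Rightarrow> 'a\<close>, where the acting group \<open>'g\<close> is \<open>int\<close> in
  dimension one and \<open>int ^ 'd\<close> in dimension \<open>d = CARD('d)\<close>. Alphabets are finite sets.\<close>

definition full_shift :: "'a set \<Rightarrow> ('g \<Rightarrow> 'a) topology" where
  "full_shift \<Gamma> = product_topology (\<lambda>_. discrete_topology \<Gamma>) UNIV"

definition shift :: "'g::ab_group_add \<Rightarrow> ('g \<Rightarrow> 'a) \<Rightarrow> 'g \<Rightarrow> 'a" where
  "shift v x = (\<lambda>w. x (v + w))"

definition shift_space :: "'a set \<Rightarrow> ('g::ab_group_add \<Rightarrow> 'a) set \<Rightarrow> bool" where
  "shift_space \<Gamma> X \<longleftrightarrow>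
     finite \<Gamma> \<and> closedin (full_shift \<Gamma>) X \<and> (\<forall>v. \<forall>x\<in>X. shift v x \<in> X)"

text \<open>A finite pattern over \<open>\<Gamma>\<close> is a partial map into \<open>\<Gamma>\<close> with finite domain.\<close>

definition patterns :: "'a set \<Rightarrow> ('g \<rightharpoonup> 'a) set" where
  "patterns \<Gamma> = {p. finite (dom p) \<and> ran p \<subseteq> \<Gamma>}"

definition occurs_in :: "('g::ab_group_add \<rightharpoonup> 'a) \<Rightarrow> ('g \<Rightarrow> 'a) \<Rightarrow> bool" where
  "occurs_in p x \<longleftrightarrow> (\<exists>v. \<forall>w\<in>dom p. p w = Some (x (v + w)))"

definition avoiding :: "'a set \<Rightarrow> ('g::ab_group_add \<rightharpoonup> 'a) set \<Rightarrow> ('g \<Rightarrow> 'a) set" where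
  "avoiding \<Gamma> F = {x. range x \<subseteq> \<Gamma> \<and> (\<forall>p\<in>F. \<not> occurs_in p x)}"

definition SFT :: "'a set \<Rightarrow> ('g::ab_group_add \<Rightarrow> 'a) set \<Rightarrow> bool" where
  "SFT \<Gamma> X \<longleftrightarrow> shift_space \<Gamma> X \<and> (\<exists>F. finite F \<and> F \<subseteq> patterns \<Gamma> \<and> X = avoiding \<Gamma> F)"

definition block_code ::
  "'a set \<Rightarrow> ('g::ab_group_add \<Rightarrow> 'a) set \<Rightarrow> 'b set \<Rightarrow> ('g \<Rightarrow> 'b) set
     \<Rightarrow> (('g \<Rightarrow> 'a) \<Rightarrow> ('g \<Rightarrow> 'b)) \<Rightarrow> bool" where
  "block_code \<Sigma> X \<Gamma> Y \<phi> \<longleftrightarrow>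
     shift_space \<Sigma> X \<and> shift_space \<Gamma> Y \<and>
     continuous_map (subtopology (full_shift \<Sigma>) X) (subtopology (full_shift \<Gamma>) Y) \<phi> \<and>
     (\<forall>v. \<forall>x\<in>X. \<phi> (shift v x) = shift v (\<phi> x))"

definition SFT_cover ::
  "'a set \<Rightarrow> ('g::ab_group_add \<Rightarrow> 'a) set \<Rightarrow> 'b set \<Rightarrow> ('g \<Rightarrow> 'b) set
     \<Rightarrow> (('g \<Rightarrow> 'a) \<Rightarrow> ('g \<Rightarrow> 'b)) \<Rightarrow> bool" where
  "SFT_cover \<Sigma> X \<Gamma> Y \<phi> \<longleftrightarrow> SFT \<Sigma> X \<and> block_code \<Sigma> X \<Gamma> Y \<phi> \<and> \<phi> ` X = Y"

text \<open>One cannot quantify over the symbol type of the cover inside a formula. Taking its alphabet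
  to be a finite set of natural numbers is no restriction, up to renaming of symbols.\<close>

definition sofic :: "'b set \<Rightarrow> ('g::ab_group_add \<Rightarrow> 'b) set \<Rightarrow> bool" where
  "sofic \<Gamma> Y \<longleftrightarrow> (\<exists>(\<Sigma> :: nat set) X \<phi>. SFT_cover \<Sigma> X \<Gamma> Y \<phi>)"

definition countably_covered :: "'b set \<Rightarrow> ('g::ab_group_add \<Rightarrow> 'b) set \<Rightarrow> bool" where
  "countably_covered \<Gamma> Y \<longleftrightarrow> (\<exists>(\<Sigma> :: nat set) X \<phi>. SFT_cover \<Sigma> X \<Gamma> Y \<phi> \<and> countable X)"

section \<open>One-dimensional conditions\<close>

text \<open>Symbols are numbered by an injection \<open>e\<close> of the alphabet into the natural numbers. Since the
  alphabet is finite, the choice of \<open>e\<close> does not matter; the computability notions below ask for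
  all of them. A finite pattern is coded as the finite set of its (position, symbol) pairs.\<close>

definition pattern_code :: "('a \<Rightarrow> nat) \<Rightarrow> (int \<rightharpoonup> 'a) \<Rightarrow> nat" where
  "pattern_code e p = set_encode ((\<lambda>(n, a). prod_encode (int_encode n, e a)) ` Map.graph p)"

definition word_code :: "('a \<Rightarrow> nat) \<Rightarrow> 'a list \<Rightarrow> nat" where
  "word_code e w = list_encode (map e w)"

definition effectively_closed :: "'a set \<Rightarrow> (int \<Rightarrow> 'a) set \<Rightarrow> bool" where
  "effectively_closed \<Gamma> Y \<longleftrightarrow> shift_space \<Gamma> Y \<and>
     (\<forall>e. inj_on e \<Gamma> \<longrightarrow>
        (\<exists>F \<subseteq> patterns \<Gamma>. computably_enumerable (pattern_code e ` F) \<and> Y = avoiding \<Gamma> F))"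

definition ultimately_periodic_right :: "(int \<Rightarrow> 'a) \<Rightarrow> bool" where
  "ultimately_periodic_right y \<longleftrightarrow> (\<exists>p>0. \<exists>N. \<forall>n\<ge>N. y n = y (n + p))"

definition ultimately_periodic_left :: "(int \<Rightarrow> 'a) \<Rightarrow> bool" where
  "ultimately_periodic_left y \<longleftrightarrow> (\<exists>p>0. \<exists>N. \<forall>n\<le>N. y n = y (n - p))"

text \<open>The configuration \<open>\<dots> u u v w w \<dots>\<close> for nonempty \<open>u\<close>, \<open>w\<close>, with \<open>v\<close> starting at the
  origin.\<close>

definition bi_infinite :: "'a list \<Rightarrow> 'a list \<Rightarrow> 'a list \<Rightarrow> int \<Rightarrow> 'a" where
  "bi_infinite u v w n =
     (if n < 0 then u ! nat (n mod int (length u))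
      else if n < int (length v) then v ! nat n
      else w ! nat ((n - int (length v)) mod int (length w)))"

definition nonempty_words :: "'a set \<Rightarrow> 'a list set" where
  "nonempty_words \<Gamma> = {w. w \<noteq> [] \<and> set w \<subseteq> \<Gamma>}"

definition countable_cover_conditions_1 :: "'a set \<Rightarrow> (int \<Rightarrow> 'a) set \<Rightarrow> bool" where
  "countable_cover_conditions_1 \<Gamma> Y \<longleftrightarrow>
     shift_space \<Gamma> Y \<and>
     effectively_closed \<Gamma> Y \<and>
     (\<forall>y\<in>Y. ultimately_periodic_left y \<and> ultimately_periodic_right y) \<and>
     (\<forall>e. inj_on e \<Gamma> \<longrightarrow>
        decidable_relation 3
          {[word_code e u, word_code e v, word_code e w] | u v w.
             u \<in> nonempty_words \<Gamma> \<and> v \<in> nonempty_words \<Gamma> \<and> w \<in> nonempty_words \<Gamma> \<and>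
             bi_infinite u v w \<in> Y})"

section \<open>Vertically constant configurations\<close>

text \<open>The index type \<open>'d\<close> carries no order, so the horizontal coordinate (the first one) is an
  explicit parameter \<open>h\<close>; the remaining coordinates are the vertical ones.\<close>

definition vertically_constant :: "'d::finite \<Rightarrow> (int ^ 'd \<Rightarrow> 'a) set \<Rightarrow> bool" where
  "vertically_constant h Y \<longleftrightarrow> (\<forall>x\<in>Y. \<forall>i. i \<noteq> h \<longrightarrow> shift (axis i 1) x = x)"

definition projective_subdynamics :: "'d::finite \<Rightarrow> (int ^ 'd \<Rightarrow> 'a) set \<Rightarrow> (int \<Rightarrow> 'a) set" where
  "projective_subdynamics h Y = (\<lambda>x n. x (axis h n)) ` Y"

definition countable_cover_conditions :: "'d::finite \<Rightarrow> 'a set \<Rightarrow> (int ^ 'd \<Rightarrow> 'a) set \<Rightarrow> bool" where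
  "countable_cover_conditions h \<Gamma> Y \<longleftrightarrow>
     shift_space \<Gamma> Y \<and> vertically_constant h Y \<and>
     countable_cover_conditions_1 \<Gamma> (projective_subdynamics h Y)"

end

theory Submission
  imports Defs
begin

text \<open>
  Let \<open>X\<close> be a countable SFT that covers the vertically constant shift space \<open>Y\<close>, and call the
  coordinate \<open>h\<close> horizontal.

  Why \<open>Y\<close> is tame. The fibre of \<open>X\<close> over a configuration \<open>z\<close> of \<open>Y\<close> is nonempty, closed,
  countable and invariant under vertical shifts. A minimal closed invariant subset of it has an
  isolated point by Baire's theorem; by minimality it is the orbit of that point, and by compactness
  it is finite (\<open>finite_orbit_of_countable_compact\<close>). So \<open>z\<close> has a preimage \<open>x\<close> that is
  periodic in every vertical direction. Its columns take finitely many values, so some window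
  of columns occurs infinitely often to the right. If the columns were not ultimately periodic, two
  different blocks of the same length could be cut out between such occurrences and concatenated in
  any order; each result satisfies the finite set of local constraints, and \<open>X\<close> would be
  uncountable (\<open>eventually_periodic_if_countably_many_splices\<close>). So \<open>x\<close>, and with it
  \<open>z\<close>, is ultimately periodic in both horizontal directions.

  Why the conditions are computable. By compactness there is a finite local rule: \<open>x\<close> is a point
  of \<open>X\<close> over \<open>z\<close> iff every window of \<open>x\<close>, together with the symbol of \<open>z\<close> above it,
  belongs to a finite list (\<open>SFT_cover_local_rule\<close>). If \<open>z\<close> has no preimage, then by
  Koenig's lemma already some finite part of \<open>z\<close> has none, and this is found by a finite search
  (\<open>blocked\<close>). The finite patterns for which the search succeeds are a computably
  enumerable set of forbidden patterns for the projective subdynamics of \<open>Y\<close>. If \<open>z\<close> does have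
  a preimage, then it has one that is determined by a number \<open>q\<close> and finitely many symbols: one
  with all vertical periods \<open>q\<close> and with horizontal period \<open>q\<close> outside the strip
  from \<open>-q\<close> to \<open>q\<close>. For \<open>z\<close> of the form \<open>\<dots> u u v w w \<dots>\<close> such a preimage is
  recognised by checking the local rule in a finite box (\<open>certified\<close>). So membership
  and non-membership of these configurations both have finite witnesses, and searching for a
  witness of either kind decides the question.

  To carry this out with programs on natural numbers, the lattice is put in a bijection \<open>pos_code\<close>
  with the natural numbers under which translations, coordinates and foldings are computable.
\<close>

section \<open>Computable functions and decidable relations\<close>

text \<open>The arity \<open>k\<close> is explicit because programs act on lists of any length. The
  environment list plays the role of a context: a quantifier or a recursion pushes its variable to the
  front, so inside of it the variable is \<open>hd\<close> and the old environment is \<open>tl\<close>.\<close>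
definition computable :: "nat \<Rightarrow> (nat list \<Rightarrow> nat) \<Rightarrow> bool" where
  "computable k f \<longleftrightarrow> (\<exists>r. \<forall>xs. length xs = k \<longrightarrow> rec_eval r xs (f xs))"

definition decidable :: "nat \<Rightarrow> (nat list \<Rightarrow> bool) \<Rightarrow> bool" where
  "decidable k P \<longleftrightarrow> computable k (\<lambda>xs. of_bool (P xs))"

named_theorems computable_intros

lemma computable_cong:
  assumes "computable k f" "\<And>xs. length xs = k \<Longrightarrow> f xs = g xs"
  shows "computable k g"
  using assms unfolding computable_def by metis

lemma decidable_cong:
  assumes "decidable k P" "\<And>xs. length xs = k \<Longrightarrow> P xs \<longleftrightarrow> Q xs"
  shows "decidable k Q"
  using assms(1) unfolding decidable_def by (rule computable_cong) (simp add: assms(2))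

lemma computable_comp:
  assumes f: "computable j f" and gs: "\<forall>g\<in>set gs. computable k g" and j: "length gs = j"
  shows "computable k (\<lambda>xs. f (map (\<lambda>g. g xs) gs))"
proof -
  obtain rf where rf: "\<And>xs. length xs = j \<Longrightarrow> rec_eval rf xs (f xs)"
    using f unfolding computable_def by blast
  have "\<exists>rs. \<forall>xs. length xs = k \<longrightarrow> list_all2 (\<lambda>r y. rec_eval r xs y) rs (map (\<lambda>g. g xs) gs)"
    using gs
  proof (induction gs)
    case (Cons g gs)
    then obtain rs where rs: "\<forall>xs. length xs = k \<longrightarrow> list_all2 (\<lambda>r y. rec_eval r xs y) rs (map (\<lambda>g. g xs) gs)"
      by auto
    obtain r where "\<forall>xs. length xs = k \<longrightarrow> rec_eval r xs (g xs)"
      using Cons.prems unfolding computable_def by auto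
    with rs show ?case by (intro exI[of _ "r # rs"]) auto
  qed auto
  then obtain rs where rs:
    "\<And>xs. length xs = k \<Longrightarrow> list_all2 (\<lambda>r y. rec_eval r xs y) rs (map (\<lambda>g. g xs) gs)"
    by blast
  show ?thesis
    unfolding computable_def
    by (intro exI[of _ "Comp rf rs"] allI impI rec_eval.comp[OF rs]) (auto simp: j intro: rf)
qed

lemma computable_comp1:
  assumes "computable 1 (\<lambda>xs. F (hd xs))" "computable k f"
  shows "computable k (\<lambda>xs. F (f xs))"
  using computable_comp[OF assms(1), of "[f]" k] assms(2) by simp

lemma computable_nth: "i < k \<Longrightarrow> computable k (\<lambda>xs. xs ! i)"
  unfolding computable_def by (intro exI[of _ "Proj i"]) (auto intro: rec_eval.proj)

text \<open>Makes an environment fit a function written for another one: the first argument is replaced by a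
  computed value, and \<open>m\<close> variables that the function does not mention are dropped.\<close>
lemma computable_subst:
  assumes F: "computable (Suc k) (\<lambda>ys. F (hd ys) (tl ys))" and g: "computable (m + k) g"
  shows "computable (m + k) (\<lambda>xs. F (g xs) (drop m xs))"
proof -
  let ?gs = "g # map (\<lambda>i xs. xs ! (m + i)) [0..<k]"
  have "computable (m + k) (\<lambda>xs. (\<lambda>ys. F (hd ys) (tl ys)) (map (\<lambda>g. g xs) ?gs))"
    using F by (rule computable_comp) (auto intro: computable_nth g)
  then show ?thesis
  proof (rule computable_cong)
    fix xs :: "nat list" assume "length xs = m + k"
    then have "map (\<lambda>g. g xs) (map (\<lambda>i xs. xs ! (m + i)) [0..<k]) = drop m xs"
      by (intro nth_equalityI) auto
    then show "(\<lambda>ys. F (hd ys) (tl ys)) (map (\<lambda>g. g xs) ?gs) = F (g xs) (drop m xs)" by simp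
  qed
qed

lemma decidable_subst:
  assumes "decidable (Suc k) (\<lambda>ys. P (hd ys) (tl ys))" "computable (m + k) g"
  shows "decidable (m + k) (\<lambda>xs. P (g xs) (drop m xs))"
  using assms unfolding decidable_def by (rule computable_subst)

lemma computable_hd [computable_intros]: "computable (Suc k) hd"
proof (rule computable_cong[OF computable_nth[of 0]])
  fix xs :: "nat list" assume "length xs = Suc k"
  then show "xs ! 0 = hd xs" by (cases xs) auto
qed simp

lemma computable_tl:
  assumes "computable k f"
  shows "computable (Suc k) (\<lambda>xs. f (tl xs))"
proof -
  have "computable (Suc k) (\<lambda>xs. f (map (\<lambda>g. g xs) (map (\<lambda>i xs. xs ! Suc i) [0..<k])))"
    using assms by (rule computable_comp) (auto intro: computable_nth)
  then show ?thesis
  proof (rule computable_cong)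
    fix xs :: "nat list" assume "length xs = Suc k"
    then have "map (\<lambda>g. g xs) (map (\<lambda>i xs. xs ! Suc i) [0..<k]) = tl xs"
      by (intro nth_equalityI) (auto simp: nth_tl)
    then show "f (map (\<lambda>g. g xs) (map (\<lambda>i xs. xs ! Suc i) [0..<k])) = f (tl xs)" by simp
  qed
qed

lemmas computable_hd_tl [computable_intros] =
  computable_tl[OF computable_hd] computable_tl[OF computable_tl[OF computable_hd]]

lemma computable_Suc [computable_intros]:
  "computable k f \<Longrightarrow> computable k (\<lambda>xs. Suc (f xs))"
proof (erule computable_comp1[rotated], unfold computable_def, intro exI[of _ Succ] allI impI)
  fix xs :: "nat list" assume "length xs = 1"
  then obtain x where "xs = [x]" by (auto simp: length_Suc_conv)
  then show "rec_eval Succ xs (Suc (hd xs))" by (auto intro: rec_eval.succ)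
qed

lemma computable_const [computable_intros]: "computable k (\<lambda>_. c)"
proof (induction c)
  case 0
  show ?case unfolding computable_def by (intro exI[of _ Zero]) (auto intro: rec_eval.zero)
qed (rule computable_Suc)

text \<open>Primitive recursion with a computed bound and with access to the environment; the arithmetic
  operations and bounded quantifiers below are instances.\<close>
lemma computable_rec:
  assumes a: "computable k a"
    and s: "computable (Suc (Suc k)) (\<lambda>zs. s (hd zs) (hd (tl zs)) (tl (tl zs)))"
    and n: "computable k n"
  shows "computable k (\<lambda>xs. rec_nat (a xs) (\<lambda>i y. s i y xs) (n xs))"
proof -
  obtain ra where ra: "\<And>xs. length xs = k \<Longrightarrow> rec_eval ra xs (a xs)"
    using a unfolding computable_def by blast
  obtain rs where rs: "\<And>zs. length zs = Suc (Suc k) \<Longrightarrow>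
      rec_eval rs zs (s (hd zs) (hd (tl zs)) (tl (tl zs)))"
    using s unfolding computable_def by blast
  have *: "rec_eval (PrimRec ra rs) (m # xs) (rec_nat (a xs) (\<lambda>i y. s i y xs) m)"
    if "length xs = k" for m xs
  proof (induction m)
    case 0
    show ?case using ra[OF that] by (auto intro: rec_eval.primrec_0)
  next
    case (Suc m)
    have "rec_eval rs (m # rec_nat (a xs) (\<lambda>i y. s i y xs) m # xs)
        (s m (rec_nat (a xs) (\<lambda>i y. s i y xs) m) xs)"
      using rs[of "m # rec_nat (a xs) (\<lambda>i y. s i y xs) m # xs"] that by simp
    from rec_eval.primrec_Suc[OF Suc this] show ?case by simp
  qed
  have "computable (Suc k) (\<lambda>ys. rec_nat (a (tl ys)) (\<lambda>i y. s i y (tl ys)) (hd ys))"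
    unfolding computable_def
  proof (intro exI[of _ "PrimRec ra rs"] allI impI)
    fix ys :: "nat list" assume "length ys = Suc k"
    then obtain m xs where "ys = m # xs" "length xs = k" by (auto simp: length_Suc_conv)
    then show "rec_eval (PrimRec ra rs) ys (rec_nat (a (tl ys)) (\<lambda>i y. s i y (tl ys)) (hd ys))"
      using *[of xs m] by simp
  qed
  from computable_subst[OF this, of 0 n] n show ?thesis by simp
qed

lemma computable_pred: "computable k f \<Longrightarrow> computable k (\<lambda>xs. f xs - 1)"
proof -
  assume f: "computable k f"
  have *: "rec_nat 0 (\<lambda>i y. i) n = n - 1" for n :: nat by (cases n) auto
  have "computable k (\<lambda>xs. rec_nat 0 (\<lambda>i y. i) (f xs))"
    by (intro computable_rec[where s = "\<lambda>i y xs. i"] computable_intros f)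
  then show ?thesis by (simp only: *)
qed

lemma computable_add [computable_intros]:
  assumes "computable k f" "computable k g"
  shows "computable k (\<lambda>xs. f xs + g xs)"
proof -
  have *: "rec_nat a (\<lambda>i y. Suc y) n = a + n" for a n :: nat by (induction n) auto
  have "computable k (\<lambda>xs. rec_nat (f xs) (\<lambda>i y. Suc y) (g xs))"
    by (intro computable_rec[where s = "\<lambda>i y xs. Suc y"] computable_intros assms)
  then show ?thesis by (simp only: *)
qed

lemma computable_diff [computable_intros]:
  assumes "computable k f" "computable k g"
  shows "computable k (\<lambda>xs. f xs - g xs)"
proof -
  have *: "rec_nat a (\<lambda>i y. y - 1) n = a - n" for a n :: nat by (induction n) auto
  have "computable k (\<lambda>xs. rec_nat (f xs) (\<lambda>i y. y - 1) (g xs))"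
    by (intro computable_rec[where s = "\<lambda>i y xs. y - 1"] computable_pred computable_intros assms)
  then show ?thesis by (simp only: *)
qed

lemma computable_mult [computable_intros]:
  assumes "computable k f" "computable k g"
  shows "computable k (\<lambda>xs. f xs * g xs)"
proof -
  have *: "rec_nat 0 (\<lambda>i y. y + a) n = a * n" for a n :: nat by (induction n) auto
  have "computable k (\<lambda>xs. rec_nat 0 (\<lambda>i y. y + f xs) (g xs))"
    by (intro computable_rec[where s = "\<lambda>i y xs. y + f xs"] computable_intros assms
        computable_tl[OF computable_tl[OF assms(1)]])
  then show ?thesis by (simp only: *)
qed

lemma computable_power [computable_intros]:
  assumes "computable k f" "computable k g"
  shows "computable k (\<lambda>xs. f xs ^ g xs)"
proof -
  have *: "rec_nat 1 (\<lambda>i y. y * a) n = a ^ n" for a n :: nat by (induction n) auto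
  have "computable k (\<lambda>xs. rec_nat 1 (\<lambda>i y. y * f xs) (g xs))"
    by (intro computable_rec[where s = "\<lambda>i y xs. y * f xs"] computable_intros assms
        computable_tl[OF computable_tl[OF assms(1)]])
  then show ?thesis by (simp only: *)
qed

lemma decidable_not [computable_intros]:
  assumes "decidable k P" shows "decidable k (\<lambda>xs. \<not> P xs)"
proof -
  have "computable k (\<lambda>xs. 1 - of_bool (P xs))"
    using assms unfolding decidable_def by (intro computable_intros)
  then show ?thesis unfolding decidable_def by (rule computable_cong) auto
qed

lemma decidable_conj [computable_intros]:
  assumes "decidable k P" "decidable k Q" shows "decidable k (\<lambda>xs. P xs \<and> Q xs)"
proof -
  have "computable k (\<lambda>xs. of_bool (P xs) * of_bool (Q xs))"
    using assms unfolding decidable_def by (intro computable_intros)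
  then show ?thesis unfolding decidable_def by (rule computable_cong) auto
qed

lemma decidable_disj [computable_intros]:
  assumes "decidable k P" "decidable k Q" shows "decidable k (\<lambda>xs. P xs \<or> Q xs)"
proof -
  have "decidable k (\<lambda>xs. \<not> (\<not> P xs \<and> \<not> Q xs))"
    by (intro computable_intros assms)
  then show ?thesis by simp
qed

lemma decidable_imp [computable_intros]:
  assumes "decidable k P" "decidable k Q" shows "decidable k (\<lambda>xs. P xs \<longrightarrow> Q xs)"
proof -
  have "decidable k (\<lambda>xs. \<not> P xs \<or> Q xs)"
    by (intro computable_intros assms)
  then show ?thesis by (rule decidable_cong) auto
qed

lemma decidable_const [computable_intros]: "decidable k (\<lambda>_. P)"
  unfolding decidable_def by (rule computable_const)

lemma decidable_le [computable_intros]: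
  assumes "computable k f" "computable k g" shows "decidable k (\<lambda>xs. f xs \<le> g xs)"
proof -
  have "computable k (\<lambda>xs. 1 - (f xs - g xs))" by (intro computable_intros assms)
  then show ?thesis unfolding decidable_def by (rule computable_cong) auto
qed

lemma decidable_less [computable_intros]:
  assumes "computable k f" "computable k g" shows "decidable k (\<lambda>xs. f xs < g xs)"
  using decidable_le[OF computable_Suc[OF assms(1)] assms(2)] by (simp add: Suc_le_eq)

lemma decidable_eq [computable_intros]:
  assumes "computable k f" "computable k g" shows "decidable k (\<lambda>xs. f xs = g xs)"
proof -
  have "decidable k (\<lambda>xs. f xs \<le> g xs \<and> g xs \<le> f xs)" by (intro computable_intros assms)
  then show ?thesis by (rule decidable_cong) auto
qed

lemma computable_if [computable_intros]:
  assumes "decidable k P" "computable k f" "computable k g"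
  shows "computable k (\<lambda>xs. if P xs then f xs else g xs)"
proof -
  have "computable k (\<lambda>xs. of_bool (P xs) * f xs + (1 - of_bool (P xs)) * g xs)"
    using assms(1) unfolding decidable_def by (intro computable_intros assms)
  then show ?thesis by (rule computable_cong) auto
qed

text \<open>A bounded universal quantifier is the product of the truth values, which is a primitive
  recursion.\<close>
lemma decidable_all_less [computable_intros]:
  assumes P: "decidable (Suc k) (\<lambda>ys. P (hd ys) (tl ys))" and b: "computable k b"
  shows "decidable k (\<lambda>xs. \<forall>n<b xs. P n xs)"
proof -
  have *: "rec_nat 1 (\<lambda>i y. y * of_bool (P i xs)) m = (of_bool (\<forall>n<m. P n xs) :: nat)" for m xs
    by (induction m) (auto simp: less_Suc_eq)
  have "computable (Suc (Suc k)) (\<lambda>zs. of_bool (P (hd zs) (tl (tl zs))))"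
    using computable_subst[OF P[unfolded decidable_def], of 2 hd] computable_hd[of "Suc k"]
    by (simp add: drop_Suc numeral_2_eq_2)
  then have "computable k (\<lambda>xs. rec_nat 1 (\<lambda>i y. y * of_bool (P i xs)) (b xs))"
    by (intro computable_rec[where s = "\<lambda>i y xs. y * of_bool (P i xs)"] computable_intros b)
  then show ?thesis unfolding decidable_def * .
qed

lemma decidable_ex_less [computable_intros]:
  assumes P: "decidable (Suc k) (\<lambda>ys. P (hd ys) (tl ys))" and b: "computable k b"
  shows "decidable k (\<lambda>xs. \<exists>n<b xs. P n xs)"
proof -
  have "decidable k (\<lambda>xs. \<not> (\<forall>n<b xs. \<not> P n xs))"
    by (intro computable_intros assms)
  then show ?thesis by (rule decidable_cong) auto
qed

lemma decidable_ball_finite: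
  assumes "finite A" "\<And>a. a \<in> A \<Longrightarrow> decidable k (P a)"
  shows "decidable k (\<lambda>xs. \<forall>a\<in>A. P a xs)"
  using assms by (induction A) (auto intro: computable_intros)

lemma decidable_bex_finite:
  assumes "finite A" "\<And>a. a \<in> A \<Longrightarrow> decidable k (P a)"
  shows "decidable k (\<lambda>xs. \<exists>a\<in>A. P a xs)"
  using assms by (induction A) (auto intro: computable_intros)

text \<open>Unbounded search for a witness. The second property is what makes the domain of the search
  program equal to the set of inputs that have a witness.\<close>
lemma mu_search:
  assumes "decidable (Suc k) P"
  obtains r where
    "\<And>xs n. \<lbrakk>length xs = k; P (n # xs)\<rbrakk> \<Longrightarrow> rec_eval r xs (LEAST n. P (n # xs))"
    "\<And>xs y. \<lbrakk>length xs = k; rec_eval r xs y\<rbrakk> \<Longrightarrow> P (y # xs)"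
proof -
  from decidable_not[OF assms] obtain r where
    r: "\<And>xs. length xs = Suc k \<Longrightarrow> rec_eval r xs (of_bool (\<not> P xs))"
    unfolding decidable_def computable_def by blast
  show thesis
  proof
    fix xs n assume xs: "length xs = k" and n: "P (n # xs)"
    let ?m = "LEAST n. P (n # xs)"
    have "rec_eval r (?m # xs) 0"
      using r[of "?m # xs"] LeastI[of "\<lambda>n. P (n # xs)", OF n] xs by simp
    moreover have "\<forall>m<?m. \<exists>y>0. rec_eval r (m # xs) y"
    proof (intro allI impI)
      fix m assume "m < ?m"
      then have "\<not> P (m # xs)" by (rule not_less_Least)
      then show "\<exists>y>0. rec_eval r (m # xs) y"
        using r[of "m # xs"] xs by (intro exI[of _ 1]) auto
    qed
    ultimately show "rec_eval (Mu r) xs ?m" by (intro rec_eval.mu)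
  next
    fix xs y assume xs: "length xs = k" and "rec_eval (Mu r) xs y"
    then have "rec_eval r (y # xs) 0" by (auto elim: rec_evalE(7))
    moreover have "rec_eval r (y # xs) (of_bool (\<not> P (y # xs)))" using r[of "y # xs"] xs by simp
    ultimately have "of_bool (\<not> P (y # xs)) = (0::nat)" by (rule rec_eval_deterministic[rotated])
    then show "P (y # xs)" by simp
  qed
qed

lemma computable_Least:
  assumes P: "decidable (Suc k) (\<lambda>ys. P (hd ys) (tl ys))"
    and ex: "\<And>xs. length xs = k \<Longrightarrow> \<exists>n. P n xs"
  shows "computable k (\<lambda>xs. LEAST n. P n xs)"
proof -
  from P obtain r where r: "\<And>xs n. \<lbrakk>length xs = k; P n xs\<rbrakk> \<Longrightarrow> rec_eval r xs (LEAST n. P n xs)"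
    by (rule mu_search) auto
  then show ?thesis unfolding computable_def using ex by blast
qed

lemma computably_enumerable_ex:
  assumes "decidable 2 (\<lambda>ys. P (hd ys) (hd (tl ys)))"
  shows "computably_enumerable {m. \<exists>n. P n m}"
proof -
  obtain r where
    r1: "\<And>xs n. \<lbrakk>length xs = 1; P n (hd xs)\<rbrakk> \<Longrightarrow> rec_eval r xs (LEAST n. P n (hd xs))"
    and r2: "\<And>xs y. \<lbrakk>length xs = 1; rec_eval r xs y\<rbrakk> \<Longrightarrow> P y (hd xs)"
    by (rule mu_search[of 1 "\<lambda>ys. P (hd ys) (hd (tl ys))"])
      (use assms in \<open>auto simp: numeral_2_eq_2\<close>)
  show ?thesis
    unfolding computably_enumerable_def
  proof (intro exI[of _ r] allI iffI)
    fix m assume "m \<in> {m. \<exists>n. P n m}"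
    then show "\<exists>y. rec_eval r [m] y" using r1[of "[m]"] by auto
  next
    fix m assume "\<exists>y. rec_eval r [m] y"
    then show "m \<in> {m. \<exists>n. P n m}" using r2[of "[m]"] by auto
  qed
qed

text \<open>A relation is decidable if both it and its complement have decidable witnesses: search until a
  witness of either kind appears, and see which kind it is.\<close>
lemma decidable_by_witnesses:
  assumes P: "decidable (Suc k) (\<lambda>ys. P (hd ys) (tl ys))"
    and Q: "decidable (Suc k) (\<lambda>ys. Q (hd ys) (tl ys))"
    and P_iff: "\<And>xs. length xs = k \<Longrightarrow> R xs \<longleftrightarrow> (\<exists>n. P n xs)"
    and Q_iff: "\<And>xs. length xs = k \<Longrightarrow> \<not> R xs \<longleftrightarrow> (\<exists>n. Q n xs)"
  shows "decidable k R"
proof -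
  have L: "computable k (\<lambda>xs. LEAST n. P n xs \<or> Q n xs)"
    by (intro computable_Least decidable_disj P Q) (use P_iff Q_iff in blast)
  have "decidable k (\<lambda>xs. P (LEAST n. P n xs \<or> Q n xs) xs)"
    using decidable_subst[OF P, of 0 "\<lambda>xs. LEAST n. P n xs \<or> Q n xs"] L by simp
  then show ?thesis
  proof (rule decidable_cong)
    fix xs :: "nat list" assume xs: "length xs = k"
    have "\<exists>n. P n xs \<or> Q n xs" using P_iff[OF xs] Q_iff[OF xs] by blast
    then have "P (LEAST n. P n xs \<or> Q n xs) xs \<or> Q (LEAST n. P n xs \<or> Q n xs) xs" by (rule LeastI_ex)
    then show "P (LEAST n. P n xs \<or> Q n xs) xs \<longleftrightarrow> R xs" using P_iff[OF xs] Q_iff[OF xs] by blast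
  qed
qed

text \<open>The quotient is found by a search that is total because the case of divisor zero is cut off.\<close>
lemma computable_div [computable_intros]:
  assumes "computable k f" "computable k g"
  shows "computable k (\<lambda>xs. f xs div g xs)"
proof -
  have *: "(if g = 0 then 0 else LEAST n. g = 0 \<or> f < Suc n * g) = f div g" for f g :: nat
  proof (cases "g = 0")
    case False
    have "(LEAST n. f < Suc n * g) = f div g"
    proof (rule Least_equality)
      show "f < Suc (f div g) * g" using dividend_less_div_times[of g f] False by simp
      show "f div g \<le> n" if "f < Suc n * g" for n
        using that False by (simp add: less_Suc_eq_le[symmetric] div_less_iff_less_mult del: mult_Suc)
    qed
    with False show ?thesis by auto
  qed auto
  have ex: "\<exists>n. g = 0 \<or> f < Suc n * g" for f g :: nat
    by (intro exI[of _ f]) (cases g; simp)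
  have "computable k (\<lambda>xs. if g xs = 0 then 0 else LEAST n. g xs = 0 \<or> f xs < Suc n * g xs)"
    by (intro computable_intros computable_Least assms
        computable_tl[OF assms(1)] computable_tl[OF assms(2)] ex)
  then show ?thesis by (simp only: *)
qed

lemma computable_mod [computable_intros]:
  assumes "computable k f" "computable k g"
  shows "computable k (\<lambda>xs. f xs mod g xs)"
  unfolding modulo_nat_def by (intro computable_intros assms)

section \<open>Codes of pairs, sets and lists\<close>

lemma computable_prod_encode [computable_intros]:
  assumes "computable k f" "computable k g"
  shows "computable k (\<lambda>xs. prod_encode (f xs, g xs))"
  unfolding prod_encode_def triangle_def prod.case by (intro computable_intros assms)

lemma computable_fst_decode [computable_intros]:
  assumes "computable k f"
  shows "computable k (\<lambda>xs. fst (prod_decode (f xs)))"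
proof -
  have *: "(LEAST a. \<exists>b<Suc n. prod_encode (a, b) = n) = fst (prod_decode n)" for n
  proof (rule Least_equality)
    show "\<exists>b<Suc n. prod_encode (fst (prod_decode n), b) = n"
      using le_prod_encode_2[of "snd (prod_decode n)" "fst (prod_decode n)"]
      by (intro exI[of _ "snd (prod_decode n)"]) (simp add: less_Suc_eq_le)
  qed auto
  have ex: "\<exists>a. \<exists>b<Suc n. prod_encode (a, b) = n" for n
    using le_prod_encode_2[of "snd (prod_decode n)" "fst (prod_decode n)"]
    by (intro exI[of _ "fst (prod_decode n)"] exI[of _ "snd (prod_decode n)"])
      (simp add: less_Suc_eq_le)
  have "computable k (\<lambda>xs. LEAST a. \<exists>b<Suc (f xs). prod_encode (a, b) = f xs)"
    by (intro computable_Least ex decidable_ex_less computable_intros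
       computable_tl[OF assms] computable_tl[OF computable_tl[OF assms]])
  then show ?thesis by (simp only: *)
qed

lemma computable_snd_decode [computable_intros]:
  assumes "computable k f"
  shows "computable k (\<lambda>xs. snd (prod_decode (f xs)))"
proof -
  have *: "(LEAST b. prod_encode (fst (prod_decode n), b) = n) = snd (prod_decode n)" for n
    by (rule Least_equality) (simp, metis order_refl prod_encode_inverse snd_conv)
  have ex: "\<exists>b. prod_encode (fst (prod_decode n), b) = n" for n
    by (intro exI[of _ "snd (prod_decode n)"]) simp
  have "computable k (\<lambda>xs. LEAST b. prod_encode (fst (prod_decode (f xs)), b) = f xs)"
    by (intro computable_Least ex computable_intros computable_tl[OF assms])
  then show ?thesis by (simp only: *)
qed

lemma decidable_set_decode [computable_intros]:
  assumes "computable k f" "computable k g"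
  shows "decidable k (\<lambda>xs. f xs \<in> set_decode (g xs))"
proof -
  have "decidable k (\<lambda>xs. (g xs div 2 ^ f xs) mod 2 = 1)"
    by (intro computable_intros assms)
  then show ?thesis by (simp add: set_decode_def odd_iff_mod_2_eq_one)
qed

text \<open>Iterating the tail operation on a list code. It leaves the code \<open>0\<close> of the empty list
  fixed, because \<open>prod_decode 0\<close> is \<open>(0, 0)\<close> and \<open>0 - 1\<close> is \<open>0\<close>.\<close>
lemma list_encode_drop:
  "rec_nat c (\<lambda>i y. snd (prod_decode (y - 1))) i = list_encode (drop i (list_decode c))"
proof (induction i)
  case (Suc i)
  have 0: "snd (prod_decode 0) = 0"
    using le_prod_encode_2[of "snd (prod_decode 0)" "fst (prod_decode 0)"] by simp
  have "snd (prod_decode (list_encode l - 1)) = list_encode (tl l)" for l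
    using 0 by (cases l) auto
  then show ?case using Suc by (simp add: drop_Suc tl_drop)
qed simp

definition code_nth :: "nat \<Rightarrow> nat \<Rightarrow> nat" where
  "code_nth c i = fst (prod_decode (list_encode (drop i (list_decode c)) - 1))"

lemma code_nth: "i < length l \<Longrightarrow> code_nth (list_encode l) i = l ! i"
  by (simp add: code_nth_def Cons_nth_drop_Suc[symmetric])

lemma computable_code_drop:
  assumes "computable k c" "computable k i"
  shows "computable k (\<lambda>xs. list_encode (drop (i xs) (list_decode (c xs))))"
proof -
  have "computable k (\<lambda>xs. rec_nat (c xs) (\<lambda>_ y. snd (prod_decode (y - 1))) (i xs))"
    by (intro computable_rec[where s = "\<lambda>i y xs. snd (prod_decode (y - 1))"] computable_intros assms)
  then show ?thesis by (simp only: list_encode_drop)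
qed

lemma computable_code_nth [computable_intros]:
  assumes "computable k c" "computable k i"
  shows "computable k (\<lambda>xs. code_nth (c xs) (i xs))"
  unfolding code_nth_def by (intro computable_intros computable_code_drop assms)

lemma computable_code_length [computable_intros]:
  assumes "computable k c"
  shows "computable k (\<lambda>xs. length (list_decode (c xs)))"
proof -
  have *: "(LEAST i. list_encode (drop i l) = 0) = length l" for l
  proof (rule Least_equality)
    fix i assume "list_encode (drop i l) = 0"
    then have "drop i l = []" by (metis list_encode.simps(1) list_encode_eq)
    then show "length l \<le> i" by simp
  qed simp
  have ex: "\<exists>i. list_encode (drop i l) = 0" for l by (intro exI[of _ "length l"]) simp
  have "computable k (\<lambda>xs. LEAST i. list_encode (drop i (list_decode (c xs))) = 0)"
    by (intro computable_Least ex computable_intros computable_code_drop computable_tl[OF assms])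
  then show ?thesis by (simp only: *)
qed

section \<open>Numbering the points of the integer lattice\<close>

text \<open>Unlike \<open>list_encode\<close>, this is a bijection between the lists of any fixed positive length
  and the natural numbers, so every number is the code of a lattice point.\<close>
fun pack :: "nat list \<Rightarrow> nat" where
  "pack [] = 0"
| "pack [a] = a"
| "pack (a # b # as) = prod_encode (a, pack (b # as))"

fun unpack :: "nat \<Rightarrow> nat \<Rightarrow> nat list" where
  "unpack 0 n = []"
| "unpack (Suc 0) n = [n]"
| "unpack (Suc (Suc k)) n = fst (prod_decode n) # unpack (Suc k) (snd (prod_decode n))"

lemma length_unpack [simp]: "length (unpack k n) = k"
  by (induction k n rule: unpack.induct) auto

lemma unpack_pack: "as \<noteq> [] \<Longrightarrow> unpack (length as) (pack as) = as"
  by (induction as rule: pack.induct) auto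

lemma pack_unpack: "k > 0 \<Longrightarrow> pack (unpack k n) = n"
proof (induction k n rule: unpack.induct)
  case (3 k n)
  obtain b bs where "unpack (Suc k) (snd (prod_decode n)) = b # bs"
    by (metis length_Suc_conv length_unpack)
  with 3 show ?case by simp
qed auto

lemma computable_pack:
  "\<forall>g\<in>set gs. computable k g \<Longrightarrow> computable k (\<lambda>xs. pack (map (\<lambda>g. g xs) gs))"
  by (induction gs rule: induct_list012) (auto intro: computable_intros)

lemma computable_unpack:
  "j < m \<Longrightarrow> computable k f \<Longrightarrow> computable k (\<lambda>xs. unpack m (f xs) ! j)"
proof (induction m arbitrary: f j)
  case (Suc m)
  show ?case
  proof (cases m)
    case 0
    then show ?thesis using Suc.prems by simp
  next
    case (Suc m')
    then show ?thesis using Suc.prems Suc.IH[of "j - 1" "\<lambda>xs. snd (prod_decode (f xs))"]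
      by (cases j) (auto intro: computable_intros)
  qed
qed simp

lemma prod_encode_mono: "a \<le> a' \<Longrightarrow> b \<le> b' \<Longrightarrow> prod_encode (a, b) \<le> prod_encode (a', b')"
proof -
  assume ab: "a \<le> a'" "b \<le> b'"
  have "triangle (a + b) \<le> triangle (a' + b')"
    unfolding triangle_def using ab by (intro div_le_mono mult_le_mono) auto
  then show ?thesis using ab by (simp add: prod_encode_def)
qed

text \<open>Gives a computable bound for the codes of all points in a box.\<close>
lemma pack_mono: "list_all2 (\<le>) as bs \<Longrightarrow> pack as \<le> pack bs"
proof (induction as arbitrary: bs rule: pack.induct)
  case (3 a b as)
  from 3(2) obtain a' b' bs' where bs: "bs = a' # b' # bs'" "a \<le> a'" "list_all2 (\<le>) (b # as) (b' # bs')"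
    by (auto simp: list_all2_Cons1)
  with 3(1)[of "b' # bs'"] show ?case by (simp add: prod_encode_mono)
qed (auto simp: list_all2_Cons1)

lemma int_decode_even: "even a \<Longrightarrow> int_decode a = int (a div 2)"
  by (simp add: int_decode_def sum_decode_def)

lemma int_decode_odd: "odd a \<Longrightarrow> int_decode a = - int (a div 2) - 1"
  by (simp add: int_decode_def sum_decode_def)

lemma int_encode_nonneg: "i \<ge> 0 \<Longrightarrow> int_encode i = 2 * nat i"
  by (simp add: int_encode_def sum_encode_def)

lemma int_encode_neg: "i < 0 \<Longrightarrow> int_encode i = 2 * nat (- i - 1) + 1"
  by (simp add: int_encode_def sum_encode_def)

lemma decidable_even [computable_intros]:
  assumes "computable k f" shows "decidable k (\<lambda>xs. even (f xs))"
proof -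
  have "decidable k (\<lambda>xs. f xs mod 2 = 0)" by (intro computable_intros assms)
  then show ?thesis by (simp add: even_iff_mod_2_eq_zero)
qed

text \<open>Adding a constant integer is a composition of steps by one up or down, each of which is a case
  distinction on the code.\<close>
lemma computable_int_add:
  assumes "computable k f"
  shows "computable k (\<lambda>xs. int_encode (int_decode (f xs) + z))"
proof -
  have up: "computable k (\<lambda>xs. int_encode (int_decode (f xs) + 1))" if "computable k f" for f
  proof -
    have "computable k (\<lambda>xs. if even (f xs) then f xs + 2 else if f xs = 1 then 0 else f xs - 2)"
      by (intro computable_intros that)
    then show ?thesis
    proof (rule computable_cong)
      fix xs
      show "(if even (f xs) then f xs + 2 else if f xs = 1 then 0 else f xs - 2) =
          int_encode (int_decode (f xs) + 1)"
        by (auto simp: int_decode_even int_decode_odd int_encode_nonneg int_encode_neg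
            nat_add_distrib elim!: evenE oddE)
    qed
  qed
  have down: "computable k (\<lambda>xs. int_encode (int_decode (f xs) - 1))" if "computable k f" for f
  proof -
    have "computable k (\<lambda>xs. if f xs = 0 then 1 else if even (f xs) then f xs - 2 else f xs + 2)"
      by (intro computable_intros that)
    then show ?thesis
    proof (rule computable_cong)
      fix xs
      show "(if f xs = 0 then 1 else if even (f xs) then f xs - 2 else f xs + 2) =
          int_encode (int_decode (f xs) - 1)"
        by (auto simp: int_decode_even int_decode_odd int_encode_nonneg int_encode_neg
            nat_diff_distrib nat_add_distrib elim!: evenE oddE)
    qed
  qed
  show ?thesis
  proof (induction z rule: int_induct[of _ 0])
    case base
    show ?case using assms by simp
  next
    case (step1 i)
    from up[OF step1(2)] show ?case by (simp add: add.assoc)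
  next
    case (step2 i)
    from down[OF step2(2)] show ?case by (simp add: add_diff_eq)
  qed
qed

definition indices :: "'d::finite list" where
  "indices = (SOME ds. set ds = UNIV \<and> distinct ds)"

lemma indices: "set (indices :: 'd::finite list) = UNIV" "distinct (indices :: 'd list)"
proof -
  have "\<exists>ds :: 'd list. set ds = UNIV \<and> distinct ds" by (rule finite_distinct_list) simp
  then have "set (indices :: 'd list) = UNIV \<and> distinct (indices :: 'd list)"
    unfolding indices_def by (rule someI_ex)
  then show "set (indices :: 'd::finite list) = UNIV" "distinct (indices :: 'd list)" by auto
qed

lemma length_indices: "length (indices :: 'd::finite list) > 0"
  using indices(1) by (metis UNIV_not_empty length_greater_0_conv set_empty2)

definition pos_code :: "int ^ 'd::finite \<Rightarrow> nat" where
  "pos_code v = pack (map (\<lambda>i. int_encode (v $ i)) indices)"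

definition pos_decode :: "nat \<Rightarrow> int ^ 'd::finite" where
  "pos_decode = inv pos_code"

lemma unpack_pos_code:
  "unpack (length (indices :: 'd::finite list)) (pos_code v) = map (\<lambda>i::'d. int_encode (v $ i)) indices"
  using unpack_pack[of "map (\<lambda>i::'d. int_encode (v $ i)) indices"] length_indices[where 'd='d]
  by (simp add: pos_code_def)

lemma inj_pos_code: "inj (pos_code :: int ^ 'd::finite \<Rightarrow> nat)"
proof (rule injI)
  fix v w :: "int ^ 'd" assume "pos_code v = pos_code w"
  then have "map (\<lambda>i. int_encode (v $ i)) indices = map (\<lambda>i. int_encode (w $ i)) indices"
    by (metis unpack_pos_code)
  then show "v = w" using indices(1)[where 'd='d] by (simp add: vec_eq_iff int_encode_eq)
qed

lemma surj_pos_code: "surj (pos_code :: int ^ 'd::finite \<Rightarrow> nat)"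
proof (rule surjI)
  fix n
  let ?ds = "indices :: 'd list"
  let ?f = "\<lambda>n. \<chi> i. int_decode (the (map_of (zip ?ds (unpack (length ?ds) n)) i))"
  have "map (\<lambda>i. int_encode (?f n $ i)) ?ds = unpack (length ?ds) n"
    using indices(2)[where 'd='d]
    by (intro nth_equalityI) (auto simp: map_of_zip_nth)
  then show "pos_code (?f n) = n"
    unfolding pos_code_def using length_indices[where 'd='d] by (simp add: pack_unpack)
qed

lemma pos_decode_code [simp]: "pos_decode (pos_code v) = v"
  by (simp add: pos_decode_def inj_pos_code)

lemma pos_code_decode [simp]: "pos_code (pos_decode n :: int ^ 'd::finite) = n"
  using surj_pos_code[where 'd='d] by (simp add: pos_decode_def surj_f_inv_f)

lemma computable_coordinate:
  fixes i :: "'d::finite"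
  assumes "computable k f"
  shows "computable k (\<lambda>xs. int_encode ((pos_decode (f xs) :: int ^ 'd) $ i))"
proof -
  obtain j where j: "j < length (indices :: 'd list)" "indices ! j = i"
    using indices(1)[where 'd='d] by (metis UNIV_I in_set_conv_nth)
  have "unpack (length (indices :: 'd list)) n ! j = int_encode ((pos_decode n :: int ^ 'd) $ i)" for n
    using unpack_pos_code[of "pos_decode n :: int ^ 'd"] j by simp
  then show ?thesis using computable_unpack[OF j(1) assms] by simp
qed

lemma computable_pos_code:
  fixes g :: "'d::finite \<Rightarrow> nat list \<Rightarrow> nat"
  assumes "\<And>i. computable k (g i)"
  shows "computable k (\<lambda>xs. pos_code (\<chi> i. int_decode (g i xs)))"
  using computable_pack[of "map g indices" k] assms by (simp add: pos_code_def comp_def)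

lemma computable_translate:
  fixes b :: "int ^ 'd::finite"
  assumes "computable k f"
  shows "computable k (\<lambda>xs. pos_code (pos_decode (f xs) + b))"
proof -
  let ?g = "\<lambda>i xs. int_encode (int_decode (int_encode ((pos_decode (f xs) :: int ^ 'd) $ i)) + b $ i)"
  have "computable k (\<lambda>xs. pos_code (\<chi> i. int_decode (?g i xs)))"
    by (intro computable_pos_code computable_int_add computable_coordinate assms)
  moreover have "(\<chi> i. int_decode (?g i xs)) = pos_decode (f xs) + b" for xs
    by (simp add: vec_eq_iff)
  ultimately show ?thesis by simp
qed

text \<open>Retracts the horizontal axis onto the interval from \<open>-2q\<close> to \<open>2q - 1\<close>: points
  outside of the middle half are moved by multiples of \<open>q\<close>, those on the right into the last
  \<open>q\<close> points and those on the left into the first \<open>q\<close> points. A configuration that is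
  \<open>q\<close>-periodic on both sides of the middle half is constant on the fibres.\<close>
definition fold_int :: "nat \<Rightarrow> int \<Rightarrow> int" where
  "fold_int q i = (if - int q \<le> i \<and> i < int q then i
     else if i \<ge> 0 then int q + i mod int q else - int q - 1 - ((- i - 1) mod int q))"

definition fold_pos :: "'d::finite \<Rightarrow> nat \<Rightarrow> int ^ 'd \<Rightarrow> int ^ 'd" where
  "fold_pos h q v = (\<chi> i. if i = h then fold_int q (v $ i) else v $ i mod int q)"

lemma fold_int_code:
  "fold_int q (int_decode a) = int_decode (2 * (if a div 2 < q then a div 2 else q + (a div 2) mod q) + a mod 2)"
proof (cases "even a")
  case True
  then obtain b where "a = 2 * b" by (elim evenE)
  then show ?thesis by (auto simp: fold_int_def int_decode_even zmod_int)
next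
  case False
  then obtain b where "a = 2 * b + 1" by (elim oddE)
  then show ?thesis by (auto simp: fold_int_def int_decode_odd zmod_int)
qed

lemma mod_code:
  assumes "q > 0"
  shows "int_decode a mod int q =
    int_decode (2 * (if even a then (a div 2) mod q else q - 1 - (a div 2) mod q))"
proof (cases "even a")
  case True
  then obtain b where "a = 2 * b" by (elim evenE)
  then show ?thesis by (auto simp: int_decode_even zmod_int)
next
  case False
  then obtain b where b: "a = 2 * b + 1" by (elim oddE)
  have "int b mod int q < int q" "0 \<le> int b mod int q" using assms by simp_all
  then have "(- int b - 1) mod int q = int q - 1 - int b mod int q"
    using minus_div_mult_eq_mod[of "int b" "int q"]
    by (intro int_mod_pos_eq[of _ _ "- (int b div int q) - 1"]) (auto simp: algebra_simps)
  moreover have "b mod q < q" using assms by simp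
  then have "int (q - 1 - b mod q) = int q - 1 - int (b mod q)" by linarith
  ultimately show ?thesis using b by (simp add: int_decode_even int_decode_odd zmod_int)
qed

lemma computable_fold_pos:
  fixes h :: "'d::finite"
  assumes q: "computable k q" "\<And>xs. length xs = k \<Longrightarrow> q xs > 0" and f: "computable k f"
  shows "computable k (\<lambda>xs. pos_code (fold_pos h (q xs) (pos_decode (f xs))))"
proof -
  let ?c = "\<lambda>i xs. int_encode ((pos_decode (f xs) :: int ^ 'd) $ i)"
  let ?g = "\<lambda>i xs. if i = h
    then 2 * (if ?c i xs div 2 < q xs then ?c i xs div 2 else q xs + (?c i xs div 2) mod q xs) + ?c i xs mod 2
    else 2 * (if even (?c i xs) then (?c i xs div 2) mod q xs else q xs - 1 - (?c i xs div 2) mod q xs)"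
  have "computable k (\<lambda>xs. pos_code (\<chi> i. int_decode (?g i xs)))"
    by (intro computable_pos_code computable_intros computable_coordinate q f)
  then show ?thesis
  proof (rule computable_cong)
    fix xs :: "nat list" assume "length xs = k"
    then have "q xs > 0" by (rule q)
    then have "(\<chi> i. int_decode (?g i xs)) = fold_pos h (q xs) (pos_decode (f xs))"
      by (simp add: vec_eq_iff fold_pos_def mod_code[symmetric] fold_int_code[symmetric])
    then show "pos_code (\<chi> i. int_decode (?g i xs)) = pos_code (fold_pos h (q xs) (pos_decode (f xs)))"
      by simp
  qed
qed

text \<open>\<open>6 * q\<close> bounds the codes of the integers of absolute value at most \<open>3 * q\<close>.\<close>
definition box_bound :: "'d::finite itself \<Rightarrow> nat \<Rightarrow> nat" where
  "box_bound _ q = Suc (pack (replicate (length (indices :: 'd list)) (6 * q)))"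

lemma computable_box_bound:
  assumes "computable k q"
  shows "computable k (\<lambda>xs. box_bound TYPE('d::finite) (q xs))"
proof -
  have "computable k (\<lambda>xs. 6 * q xs)" by (intro computable_intros assms)
  then have "computable k (\<lambda>xs. Suc (pack (map (\<lambda>g. g xs)
      (replicate (length (indices :: 'd list)) (\<lambda>xs. 6 * q xs)))))"
    by (intro computable_Suc computable_pack) auto
  then show ?thesis by (simp add: box_bound_def map_replicate)
qed

lemma pos_code_less_box_bound:
  fixes v :: "int ^ 'd::finite"
  assumes "\<And>i. \<bar>v $ i\<bar> \<le> 3 * int q"
  shows "pos_code v < box_bound TYPE('d) q"
proof -
  have "int_encode (v $ i) \<le> 6 * q" for i
    using assms[of i] by (cases "v $ i \<ge> 0") (auto simp: int_encode_nonneg int_encode_neg)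
  then show ?thesis
    unfolding pos_code_def box_bound_def less_Suc_eq_le
    by (intro pack_mono) (auto simp: list_all2_conv_all_nth)
qed

section \<open>Finite orbits in countable compact spaces\<close>

text \<open>Otherwise the space would be a countable union of closed sets without interior points, its
  singletons, against Baire's theorem.\<close>
lemma isolated_point_of_countable_compact:
  assumes "compact_space X" "Hausdorff_space X" "countable (topspace X)" "topspace X \<noteq> {}"
  obtains x where "x \<in> topspace X" "openin X {x}"
proof -
  have "X interior_of \<Union>((\<lambda>x. {x}) ` topspace X) = {}" if no: "\<forall>x\<in>topspace X. \<not> openin X {x}"
  proof (rule Baire_category_alt)
    show "completely_metrizable_space X \<or> locally_compact_space X \<and> regular_space X"
      using assms(1,2) compact_imp_locally_compact_space compact_Hausdorff_or_regular_imp_normal_space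
        by (metis compact_Hausdorff_imp_regular_space)
    show "countable ((\<lambda>x. {x}) ` topspace X)" using assms(3) by blast
  next
    fix T assume "T \<in> (\<lambda>x. {x}) ` topspace X"
    then obtain x where x: "T = {x}" "x \<in> topspace X" by blast
    have "X interior_of {x} \<noteq> {x}" using no x by (metis openin_interior_of)
    then show "closedin X T \<and> X interior_of T = {}"
      using x closedin_Hausdorff_sing_eq[OF assms(2)] interior_of_subset[of X "{x}"] by auto
  qed
  moreover have "\<Union>((\<lambda>x. {x}) ` topspace X) = topspace X" by auto
  ultimately show thesis using assms(4) that by (metis interior_of_topspace)
qed

text \<open>A minimal nonempty closed invariant set \<open>M\<close> exists by Zorn's lemma and compactness. It has an
  isolated point \<open>x\<close>. All points of the orbit of \<open>x\<close> are isolated as well, so the orbit is open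
  in \<open>M\<close>, and its complement in \<open>M\<close> is closed and invariant, hence empty. A compact set all of
  whose points are isolated is finite. The group is given only through its action, as the set \<open>G\<close>
  of homeomorphisms.\<close>
lemma finite_orbit_of_countable_compact:
  assumes X: "compact_space X" "Hausdorff_space X" "countable (topspace X)" "topspace X \<noteq> {}"
    and cont: "\<And>g. g \<in> G \<Longrightarrow> continuous_map X X g"
    and one: "\<And>x. x \<in> topspace X \<Longrightarrow> \<exists>g\<in>G. g x = x"
    and comp: "\<And>g h x. \<lbrakk>g \<in> G; h \<in> G; x \<in> topspace X\<rbrakk> \<Longrightarrow> \<exists>k\<in>G. k x = g (h x)"
    and inv: "\<And>g. g \<in> G \<Longrightarrow> \<exists>h\<in>G. \<forall>x\<in>topspace X. h (g x) = x \<and> g (h x) = x"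
  obtains x where "x \<in> topspace X" "finite ((\<lambda>g. g x) ` G)"
proof -
  have into: "g x \<in> topspace X" if "g \<in> G" "x \<in> topspace X" for g x
    using cont[OF that(1)] that(2) by (auto simp: continuous_map_def)
  \<comment> \<open>Zorn's lemma is applied to complements, so that chains are handled by unions of open sets.\<close>
  define \<A> where "\<A> = {U. openin X U \<and> U \<noteq> topspace X \<and>
      (\<forall>g\<in>G. \<forall>x\<in>topspace X - U. g x \<notin> U)}"
  have "\<exists>M\<in>\<A>. \<forall>U\<in>\<A>. M \<subseteq> U \<longrightarrow> U = M"
  proof (rule subset_Zorn_nonempty)
    show "\<A> \<noteq> {}" using X(4) unfolding \<A>_def by blast
  next
    fix \<C> assume ne: "\<C> \<noteq> {}" and chain: "subset.chain \<A> \<C>"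
    then have sub: "\<C> \<subseteq> \<A>" by (simp add: subset_chain_def)
    have "\<Union>\<C> \<noteq> topspace X"
    proof
      assume eq: "\<Union>\<C> = topspace X"
      obtain \<F> where \<F>: "finite \<F>" "\<F> \<subseteq> \<C>" "topspace X \<subseteq> \<Union>\<F>"
        using X(1) eq sub unfolding compact_space_alt \<A>_def
        by (metis (mono_tags, lifting) mem_Collect_eq order_refl subset_iff)
      then have "\<F> \<noteq> {}" using X(4) by auto
      moreover have "subset.chain \<A> \<F>"
        using chain \<F>(2) by (metis (no_types, lifting) subset_chain_def subset_iff)
      ultimately have "\<Union>\<F> \<in> \<F>" using \<F>(1) by (simp add: Union_in_chain)
      then have "\<Union>\<F> \<in> \<A>" using \<F>(2) sub by blast
      then have "openin X (\<Union>\<F>)" "\<Union>\<F> \<noteq> topspace X" unfolding \<A>_def by simp_all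
      then show False using \<F>(3) openin_subset[of X "\<Union>\<F>"] by simp
    qed
    moreover have "openin X (\<Union>\<C>)" using sub unfolding \<A>_def by auto
    moreover have "g x \<notin> \<Union>\<C>" if "g \<in> G" "x \<in> topspace X - \<Union>\<C>" for g x
    proof
      assume "g x \<in> \<Union>\<C>"
      then obtain U where U: "U \<in> \<C>" "g x \<in> U" by blast
      then have "\<forall>g\<in>G. \<forall>x\<in>topspace X - U. g x \<notin> U" using sub unfolding \<A>_def by blast
      then show False using U that by blast
    qed
    ultimately show "\<Union>\<C> \<in> \<A>" unfolding \<A>_def by blast
  qed
  then obtain U where U: "U \<in> \<A>" and max: "\<And>V. V \<in> \<A> \<Longrightarrow> U \<subseteq> V \<Longrightarrow> V = U" by blast
  define M where "M = topspace X - U"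
  have M: "closedin X M" "M \<noteq> {}" "M \<subseteq> topspace X"
    using U openin_subset unfolding M_def \<A>_def by blast+
  have Minv: "g x \<in> M" if "g \<in> G" "x \<in> M" for g x
    using U that into[OF that(1)] unfolding M_def \<A>_def by blast
  have top: "topspace (subtopology X M) = M" using M by auto
  obtain x where x: "x \<in> M" "openin (subtopology X M) {x}"
    using isolated_point_of_countable_compact[of "subtopology X M"] X M top
    by (metis Hausdorff_space_subtopology closedin_compact_space compact_space_subtopology countable_subset)
  define O' where "O' = (\<lambda>g. g x) ` G"
  have O'M: "O' \<subseteq> M" unfolding O'_def using Minv x by blast
  have iso: "openin (subtopology X M) {g x}" if g: "g \<in> G" for g
  proof -
    obtain h where h: "h \<in> G" "\<forall>y\<in>topspace X. h (g y) = y \<and> g (h y) = y" using inv[OF g] by blast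
    have "continuous_map (subtopology X M) (subtopology X M) h"
      using cont[OF h(1)] Minv[OF h(1)] top
      by (auto simp: continuous_map_in_subtopology intro: continuous_map_from_subtopology)
    from openin_continuous_map_preimage[OF this x(2)]
    have "openin (subtopology X M) {y \<in> M. h y = x}" unfolding top by simp
    moreover have "{y \<in> M. h y = x} = {g x}"
      using h(2) x(1) M(3) Minv[OF g x(1)] by auto
    ultimately show ?thesis by simp
  qed
  have "openin (subtopology X M) O'"
  proof -
    have "O' = \<Union>((\<lambda>g. {g x}) ` G)" unfolding O'_def by auto
    then show ?thesis using iso by auto
  qed
  then have cl: "closedin X (M - O')"
    using M(1) by (metis closedin_diff closedin_subtopology_refl closedin_trans_full
        closedin_topspace top)
  have "M - O' = {}"
  proof (rule ccontr)
    assume ne: "M - O' \<noteq> {}"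
    have "topspace X - (M - O') \<in> \<A>"
      unfolding \<A>_def
    proof (intro CollectI conjI ballI)
      show "openin X (topspace X - (M - O'))" using cl by blast
      show "topspace X - (M - O') \<noteq> topspace X" using ne M(3) by blast
    next
      fix g y assume g: "g \<in> G" and y: "y \<in> topspace X - (topspace X - (M - O'))"
      then have y: "y \<in> M" "y \<notin> O'" by auto
      have "g y \<notin> O'"
      proof
        assume "g y \<in> O'"
        then obtain k where k: "k \<in> G" "g y = k x" unfolding O'_def by blast
        obtain h where h: "h \<in> G" "\<forall>y\<in>topspace X. h (g y) = y \<and> g (h y) = y" using inv[OF g] by blast
        have "y = h (k x)" using h(2) y(1) M(3) k(2) by (metis subset_iff)
        moreover obtain l where "l \<in> G" "h (k x) = l x" using comp[OF h(1) k(1), of x] x(1) M(3) by force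
        ultimately show False using y(2) unfolding O'_def by blast
      qed
      then show "g y \<notin> topspace X - (M - O')" using Minv[OF g y(1)] by blast
    qed
    moreover have "U \<subseteq> topspace X - (M - O')"
      using U openin_subset unfolding M_def \<A>_def by blast
    ultimately have "topspace X - (M - O') = U" by (rule max)
    then have "M - O' = M" using M(3) unfolding M_def by blast
    moreover have "x \<in> O'" using one[of x] x(1) M(3) unfolding O'_def by (metis image_eqI subsetD)
    ultimately show False using x(1) by blast
  qed
  then have "M = O'" using O'M by blast
  moreover have "finite M"
  proof -
    have "compactin (subtopology X M) M"
      using closedin_compact_space[OF X(1) M(1)] by (simp add: compactin_subtopology)
    moreover have "\<And>T. T \<in> (\<lambda>y. {y}) ` M \<Longrightarrow> openin (subtopology X M) T"
      using iso \<open>M = O'\<close> unfolding O'_def by auto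
    ultimately obtain \<F> where "finite \<F>" "\<F> \<subseteq> (\<lambda>y. {y}) ` M" "M \<subseteq> \<Union>\<F>"
      using compactinD[of "subtopology X M" M "(\<lambda>y. {y}) ` M"] by auto
    then show ?thesis by (metis finite_Union finite_subset finite.emptyI finite.insertI imageE subset_iff)
  qed
  ultimately show thesis using that[of x] x(1) M(3) unfolding O'_def by blast
qed

section \<open>Topology of full shifts\<close>

lemma topspace_full_shift: "topspace (full_shift A) = {x. range x \<subseteq> A}"
  by (auto simp: full_shift_def PiE_def Pi_def)

lemma compact_full_shift: "finite A \<Longrightarrow> compact_space (full_shift A)"
  by (simp add: full_shift_def compact_space_product_topology compact_space_discrete_topology)

lemma Hausdorff_full_shift: "Hausdorff_space (full_shift A)"
  by (simp add: full_shift_def Hausdorff_space_product_topology Hausdorff_space_discrete_topology)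

lemma continuous_map_coordinate: "continuous_map (full_shift A) (discrete_topology A) (\<lambda>x. x v)"
  unfolding full_shift_def by (rule continuous_map_product_projection) simp

lemma continuous_map_into_full_shift:
  "continuous_map X (full_shift A) f \<longleftrightarrow> (\<forall>v. continuous_map X (discrete_topology A) (\<lambda>x. f x v))"
  unfolding full_shift_def by (simp add: continuous_map_componentwise_UNIV)

lemma continuous_map_shift: "continuous_map (full_shift A) (full_shift A) (shift v)"
  unfolding continuous_map_into_full_shift shift_def by (simp add: continuous_map_coordinate)

lemma shift_add: "shift u (shift v x) = shift (v + u) x"
  by (simp add: shift_def add.assoc)

lemma shift_0 [simp]: "shift 0 x = x"
  by (simp add: shift_def)

lemma shift_space_range: "shift_space A X \<Longrightarrow> x \<in> X \<Longrightarrow> range x \<subseteq> A"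
  using closedin_subset[of "full_shift A" X] by (auto simp: shift_space_def topspace_full_shift)

lemma finite_orbit_in_countable_closed_set:
  fixes M :: "('g::ab_group_add \<Rightarrow> 'a) set"
  assumes "finite A" "closedin (full_shift A) M" "countable M" "M \<noteq> {}"
    and inv: "\<And>v x. v \<in> V \<Longrightarrow> x \<in> M \<Longrightarrow> shift v x \<in> M"
    and V: "0 \<in> V" "\<And>u v. u \<in> V \<Longrightarrow> v \<in> V \<Longrightarrow> u + v \<in> V" "\<And>v. v \<in> V \<Longrightarrow> - v \<in> V"
  obtains x where "x \<in> M" "finite ((\<lambda>v. shift v x) ` V)"
proof -
  let ?X = "subtopology (full_shift A) M"
  have top: "topspace ?X = M" using closedin_subset[OF assms(2)] by auto
  obtain x where x: "x \<in> topspace ?X" "finite ((\<lambda>g. g x) ` (shift ` V))"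
  proof (rule finite_orbit_of_countable_compact[of ?X "shift ` V"])
    show "compact_space ?X"
      by (intro compact_space_subtopology closedin_compact_space compact_full_shift assms)
    show "Hausdorff_space ?X" by (intro Hausdorff_space_subtopology Hausdorff_full_shift)
    show "countable (topspace ?X)" "topspace ?X \<noteq> {}" using assms top by simp_all
  next
    fix g :: "('g \<Rightarrow> 'a) \<Rightarrow> 'g \<Rightarrow> 'a" assume "g \<in> shift ` V"
    then show "continuous_map ?X ?X g"
      using inv top
      by (auto simp: continuous_map_in_subtopology intro!: continuous_map_from_subtopology continuous_map_shift)
  next
    fix x assume "x \<in> topspace ?X"
    then show "\<exists>g\<in>shift ` V. g x = x" using V(1) by (auto intro!: bexI[of _ 0])
  next
    fix g h :: "('g \<Rightarrow> 'a) \<Rightarrow> 'g \<Rightarrow> 'a" and x assume "g \<in> shift ` V" "h \<in> shift ` V"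
    then show "\<exists>k\<in>shift ` V. k x = g (h x)" using V(2) by (auto simp: shift_add)
  next
    fix g :: "('g \<Rightarrow> 'a) \<Rightarrow> 'g \<Rightarrow> 'a" assume "g \<in> shift ` V"
    then obtain v where v: "g = shift v" "v \<in> V" by blast
    then show "\<exists>h\<in>shift ` V. \<forall>x\<in>topspace ?X. h (g x) = x \<and> g (h x) = x"
      using V(3)[OF v(2)] by (intro bexI[of _ "shift (- v)"]) (auto simp: shift_add)
  qed (rule that, use top in \<open>auto simp: image_image\<close>)
  then show thesis using that top by (auto simp: image_image)
qed

text \<open>The Curtis-Hedlund-Lyndon theorem: by continuity each point has a cylinder on which the symbol at
  the origin is constant, and by compactness finitely many of these cylinders suffice.\<close>
lemma block_code_local:
  fixes X :: "('g::ab_group_add \<Rightarrow> 'a) set"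
  assumes "block_code A X B Y \<phi>"
  obtains W where "finite W"
    "\<And>x x'. \<lbrakk>x \<in> X; x' \<in> X; \<forall>w\<in>W. x w = x' w\<rbrakk> \<Longrightarrow> \<phi> x 0 = \<phi> x' 0"
proof -
  let ?X = "subtopology (full_shift A) X"
  have X: "finite A" "closedin (full_shift A) X" using assms by (auto simp: block_code_def shift_space_def)
  have top: "topspace ?X = X" using closedin_subset[OF X(2)] by auto
  have comp: "compactin (full_shift A) X" using closedin_compact_space[OF compact_full_shift X(2)] X(1) .
  have "continuous_map ?X (full_shift B) \<phi>"
    using assms by (auto simp: block_code_def continuous_map_in_subtopology)
  then have cont: "continuous_map ?X (discrete_topology B) (\<lambda>x. \<phi> x 0)"
    by (simp add: continuous_map_into_full_shift)
  have "\<exists>W. finite W \<and> (\<forall>x'\<in>X. (\<forall>w\<in>W. x' w = x w) \<longrightarrow> \<phi> x' 0 = \<phi> x 0)" if x: "x \<in> X" for x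
  proof -
    have "\<phi> x 0 \<in> B" using cont x top by (auto simp: continuous_map_def)
    then have "openin ?X {y \<in> topspace ?X. \<phi> y 0 \<in> {\<phi> x 0}}"
      by (intro openin_continuous_map_preimage[OF cont]) simp
    then obtain U where U: "openin (full_shift A) U" "{y \<in> X. \<phi> y 0 = \<phi> x 0} = U \<inter> X"
      unfolding openin_subtopology top by auto
    have "x \<in> U" using U(2) x by auto
    then obtain F where F: "finite {i. F i \<noteq> A}" "x \<in> Pi\<^sub>E UNIV F" "Pi\<^sub>E UNIV F \<subseteq> U"
      using U(1) unfolding full_shift_def openin_product_topology_alt by auto
    have "\<phi> x' 0 = \<phi> x 0" if x': "x' \<in> X" "\<forall>w\<in>{i. F i \<noteq> A}. x' w = x w" for x'
    proof -
      have "x' i \<in> F i" for i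
        using F(2) x' shift_space_range[of A X x'] assms
        by (cases "F i = A") (auto simp: block_code_def PiE_def Pi_def)
      then have "x' \<in> U" using F(3) by auto
      then show ?thesis using U(2) x'(1) by auto
    qed
    with F(1) show ?thesis by blast
  qed
  then obtain W where W: "\<And>x. x \<in> X \<Longrightarrow> finite (W x)"
    "\<And>x x'. \<lbrakk>x \<in> X; x' \<in> X; \<forall>w\<in>W x. x' w = x w\<rbrakk> \<Longrightarrow> \<phi> x' 0 = \<phi> x 0"
    by metis
  define cyl where "cyl = (\<lambda>x. {x'\<in>topspace (full_shift A). \<forall>w\<in>W x. x' w = x w})"
  have xA: "x v \<in> A" if "x \<in> X" for x v
    using assms that shift_space_range[of A X x] by (auto simp: block_code_def)
  have opn: "openin (full_shift A) (cyl x)" if x: "x \<in> X" for x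
  proof -
    have "openin (full_shift A) {y \<in> topspace (full_shift A). y w \<in> {x w}}" for w
      by (rule openin_continuous_map_preimage[OF continuous_map_coordinate]) (use xA[OF x] in simp)
    then have "openin (full_shift A) (topspace (full_shift A) \<inter> \<Inter>((\<lambda>w. {y \<in> topspace (full_shift A). y w = x w}) ` W x))"
      using W(1)[OF x] by (cases "W x = {}") (auto intro!: openin_Inter openin_Int simp: Int_absorb1)
    moreover have "topspace (full_shift A) \<inter> \<Inter>((\<lambda>w. {y \<in> topspace (full_shift A). y w = x w}) ` W x) = cyl x"
      unfolding cyl_def by auto
    ultimately show ?thesis by simp
  qed
  have "X \<subseteq> \<Union>(cyl ` X)" using closedin_subset[OF X(2)] unfolding cyl_def by auto
  then obtain \<F> where \<F>: "finite \<F>" "\<F> \<subseteq> cyl ` X" "X \<subseteq> \<Union>\<F>"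
    using compactinD[OF comp, of "cyl ` X"] opn by blast
  then obtain S where S: "S \<subseteq> X" "finite S" "\<F> = cyl ` S" by (meson finite_subset_image)
  show thesis
  proof
    show "finite (\<Union>(W ` S))" using S W(1) by auto
  next
    fix x x' assume x: "x \<in> X" "x' \<in> X" and eq: "\<forall>w\<in>\<Union>(W ` S). x w = x' w"
    obtain s where s: "s \<in> S" "x \<in> cyl s" using x(1) \<F>(3) S(3) by auto
    then have "\<phi> x 0 = \<phi> s 0" using W(2)[of s x] S(1) x(1) unfolding cyl_def by auto
    moreover have "\<phi> x' 0 = \<phi> s 0" using W(2)[of s x'] S(1) x(2) s eq unfolding cyl_def by auto
    ultimately show "\<phi> x 0 = \<phi> x' 0" by simp
  qed
qed

section \<open>Sequences with countably many splices\<close>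

text \<open>The set that is assumed to be countable consists of the sequences all of whose windows of
  length \<open>m\<close> are windows of \<open>C\<close>. Some window of \<open>C\<close> recurs infinitely often; let
  \<open>n1\<close> and \<open>n2\<close> be two of its positions. If \<open>C\<close> read from \<open>n1\<close> and from \<open>n2\<close> gives
  the same sequence, then \<open>C\<close> has period \<open>n2 - n1\<close> from \<open>n1\<close> on. Otherwise let \<open>n3\<close> be a
  position of the same window behind the first difference, \<open>a\<close> the block of \<open>C\<close> from \<open>n1\<close>
  to \<open>n2\<close>, and \<open>b\<close> the one from \<open>n2\<close> to \<open>n3\<close>. Then \<open>ab\<close> and \<open>ba\<close> are different
  words of the same length, and they may be concatenated in any order, since every block is followed
  by the same window. This gives uncountably many sequences.\<close>
lemma eventually_periodic_if_countably_many_splices: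
  fixes C :: "int \<Rightarrow> 'c"
  assumes fin: "finite (range C)"
    and count: "countable {z. \<forall>t. \<exists>t'. \<forall>i. 0 \<le> i \<and> i < m \<longrightarrow> z (t + i) = C (t' + i)}"
  shows "ultimately_periodic_right C"
proof -
  \<comment> \<open>a positive window length, so that windows at different multiples of it do not overlap\<close>
  define m' where "m' = max 1 m"
  have m': "m' > 0" "m \<le> m'" by (auto simp: m'_def)
  let ?st = "\<lambda>k::nat. map (\<lambda>i. C (int k * m' + int i)) [0..<nat m']"
  have "finite (range ?st)"
    by (rule finite_subset[OF _ finite_lists_length_eq[OF fin, of "nat m'"]]) auto
  then obtain k0 where inf: "infinite {k. ?st k = ?st k0}"
    using pigeonhole_infinite[of UNIV ?st] by auto
  then have ex: "\<exists>k>j. ?st k = ?st k0" for j by (auto simp: infinite_nat_iff_unbounded)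
  have st: "C (int k * m' + i) = C (int l * m' + i)" if "?st k = ?st l" "0 \<le> i" "i < m'" for k l i
  proof -
    from that(2,3) have "nat i < nat m'" "int (nat i) = i" by auto
    with arg_cong[OF that(1), of "\<lambda>l. l ! nat i"] show ?thesis by simp
  qed
  obtain k1 where k1: "k1 > k0" "?st k1 = ?st k0" using ex by blast
  define n1 where "n1 = int k0 * m'"
  define n2 where "n2 = int k1 * m'"
  have gap: "int k * m' + m' \<le> int l * m'" if "k < l" for k l
  proof -
    have "(int k + 1) * m' \<le> int l * m'" using that m' by (intro mult_right_mono) auto
    then show ?thesis by (simp add: algebra_simps)
  qed
  have n12: "n1 + m' \<le> n2" unfolding n1_def n2_def using gap[OF k1(1)] .
  have n12C: "C (n2 + i) = C (n1 + i)" if "0 \<le> i" "i < m'" for i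
    unfolding n1_def n2_def using st[OF k1(2) that] .
  have "C (n1 + j) = C (n2 + j)" if "j \<ge> 0" for j
  proof (rule ccontr)
    assume neq: "C (n1 + j) \<noteq> C (n2 + j)"
    obtain k2 where k2: "k2 > max k1 (nat (n2 + j))" "?st k2 = ?st k0" using ex by blast
    define n3 where "n3 = int k2 * m'"
    have n23: "n2 + m' \<le> n3" unfolding n2_def n3_def using gap[of k1 k2] k2(1) by simp
    have n13C: "C (n3 + i) = C (n1 + i)" if "0 \<le> i" "i < m'" for i
      unfolding n1_def n3_def using st[OF k2(2) that] .
    have "n2 + j < int k2" using k2(1) by linarith
    also have "\<dots> \<le> n3" unfolding n3_def using m' by (simp add: mult_le_cancel_left1)
    finally have j: "n2 + j < n3" .
    define len where "len = n3 - n1"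
    have len: "len > 0" using n12 n23 m' by (simp add: len_def)
    \<comment> \<open>the place of \<open>C\<close> that is copied to offset \<open>j\<close> of a block: the block is \<open>ab\<close> if the flag is set, and \<open>ba\<close> otherwise\<close>
    define src where "src = (\<lambda>b j. if b then n1 + j
        else if j < n3 - n2 then n2 + j else n1 + (j - (n3 - n2)))"
    define z where "z = (\<lambda>(\<alpha> :: int \<Rightarrow> bool) t. C (src (\<alpha> (t div len)) (t mod len)))"
    have zin: "z \<alpha> \<in> {z. \<forall>t. \<exists>t'. \<forall>i. 0 \<le> i \<and> i < m \<longrightarrow> z (t + i) = C (t' + i)}" for \<alpha>
    proof (intro CollectI allI)
      fix t
      define k where "k = t div len"
      define r where "r = t mod len"
      have r: "0 \<le> r" "r < len" using len by (auto simp: r_def)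
      have t: "t = len * k + r" by (simp add: k_def r_def)
      have *: "C (src (\<alpha> k) r + i) = z \<alpha> (t + i)" if i: "0 \<le> i" "i < m'" for i
      proof (cases "r + i < len")
        case True
        then have "(t + i) div len = k" "(t + i) mod len = r + i"
          using r i unfolding t by (auto simp: add.assoc)
        then have "z \<alpha> (t + i) = C (src (\<alpha> k) (r + i))" by (simp add: z_def)
        also have "\<dots> = C (src (\<alpha> k) r + i)"
        proof (cases "\<not> \<alpha> k \<and> r < n3 - n2 \<and> r + i \<ge> n3 - n2")
          case True
          define i' where "i' = r + i - (n3 - n2)"
          have "src (\<alpha> k) (r + i) = n1 + i'" "src (\<alpha> k) r + i = n3 + i'"
            using True by (auto simp: src_def i'_def)
          moreover have "C (n3 + i') = C (n1 + i')" using n13C[of i'] True i r by (simp add: i'_def)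
          ultimately show ?thesis by simp
        next
          case False
          then have "src (\<alpha> k) (r + i) = src (\<alpha> k) r + i" using i by (auto simp: src_def)
          then show ?thesis by simp
        qed
        finally show ?thesis by simp
      next
        case False
        have "m' \<le> len" using n12 n23 m' by (simp add: len_def)
        define i' where "i' = r + i - len"
        have i': "0 \<le> i'" "i' < m'" "i' < len" "i' < n3 - n2"
          using False r i \<open>m' \<le> len\<close> n23 by (auto simp: i'_def)
        have "t + i = len * (k + 1) + i'" by (simp add: t i'_def algebra_simps)
        then have "(t + i) div len = k + 1" "(t + i) mod len = i'" using i' by auto
        then have "z \<alpha> (t + i) = C (src (\<alpha> (k + 1)) i')" by (simp add: z_def)
        also have "\<dots> = C (n1 + i')" using i' n12C[of i'] by (auto simp: src_def)
        also have "\<dots> = C (src (\<alpha> k) r + i)"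
        proof (cases "\<alpha> k")
          case True
          have "n1 + r + i = n3 + i'" by (simp add: i'_def len_def)
          then show ?thesis using n13C[of i'] i' True by (simp add: src_def)
        next
          case False
          have "r \<ge> n3 - n2"
            using \<open>\<not> r + i < len\<close> i n12 n23 by (simp add: len_def)
          moreover have "n1 + (r - (n3 - n2)) + i = n2 + i'" by (simp add: i'_def len_def)
          ultimately have "src (\<alpha> k) r + i = n2 + i'" using False by (simp add: src_def)
          then show ?thesis using n12C[of i'] i' by simp
        qed
        finally show ?thesis by simp
      qed
      show "\<exists>t'. \<forall>i. 0 \<le> i \<and> i < m \<longrightarrow> z \<alpha> (t + i) = C (t' + i)"
        using * m'(2) by (intro exI[of _ "src (\<alpha> k) r"]) auto
    qed
    have "inj z"
    proof (rule injI, rule ext)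
      fix \<alpha> \<beta> k assume eq: "z \<alpha> = z \<beta>"
      have jl: "0 \<le> j" "j < len" "j < n3 - n2" using j that n12 m' by (auto simp: len_def)
      then have "(len * k + j) div len = k" "(len * k + j) mod len = j" by auto
      then have "z \<gamma> (len * k + j) = C (src (\<gamma> k) j)" for \<gamma> by (simp add: z_def)
      with eq have "C (src (\<alpha> k) j) = C (src (\<beta> k) j)" by metis
      then show "\<alpha> k = \<beta> k" using neq jl by (auto simp: src_def split: if_splits)
    qed
    moreover have "countable (range z)" using zin by (intro countable_subset[OF _ count]) blast
    ultimately have "countable (UNIV :: (int \<Rightarrow> bool) set)"
      by (metis countable_image_inj_on)
    moreover have "uncountable (UNIV :: (int \<Rightarrow> bool) set)"
    proof
      assume "countable (UNIV :: (int \<Rightarrow> bool) set)"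
      then obtain f :: "nat \<Rightarrow> int \<Rightarrow> bool" where "range f = UNIV"
        by (metis UNIV_not_empty range_from_nat_into)
      \<comment> \<open>Cantor's diagonal argument\<close>
      then obtain n where "f n = (\<lambda>i. \<not> f (nat i) i)" by (metis (no_types, lifting) UNIV_I imageE)
      then have "f n (int n) = (\<not> f (nat (int n)) (int n))" by (rule fun_cong)
      then show False by simp
    qed
    ultimately show False by simp
  qed
  then have "C n = C (n + (n2 - n1))" if "n \<ge> n1" for n
    using that by (auto simp: algebra_simps dest!: meta_spec[of _ "n - n1"])
  moreover have "n2 - n1 > 0" using n12 m' by simp
  ultimately show ?thesis unfolding ultimately_periodic_right_def by blast
qed

text \<open>Reduces statements about the left end to the right end, as the splicing condition is
  invariant under reflection.\<close>
lemma ultimately_periodic_left_iff: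
  "ultimately_periodic_left C \<longleftrightarrow> ultimately_periodic_right (\<lambda>n. C (- n))"
proof
  assume "ultimately_periodic_left C"
  then obtain p N where p: "p > 0" "\<forall>n\<le>N. C n = C (n - p)" by (auto simp: ultimately_periodic_left_def)
  have "C (- n) = C (- (n + p))" if "n \<ge> - N" for n
    using p(2)[rule_format, of "-n"] that by (simp add: algebra_simps)
  with p(1) show "ultimately_periodic_right (\<lambda>n. C (- n))"
    unfolding ultimately_periodic_right_def by blast
next
  assume "ultimately_periodic_right (\<lambda>n. C (- n))"
  then obtain p N where p: "p > 0" "\<forall>n\<ge>N. C (- n) = C (- (n + p))"
    by (auto simp: ultimately_periodic_right_def)
  have "C n = C (n - p)" if "n \<le> - N" for n
    using p(2)[rule_format, of "-n"] that by (simp add: algebra_simps)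
  with p(1) show "ultimately_periodic_left C"
    unfolding ultimately_periodic_left_def by blast
qed

lemma ultimately_periodic_if_countably_many_splices:
  fixes C :: "int \<Rightarrow> 'c"
  assumes fin: "finite (range C)"
    and count: "countable {z. \<forall>t. \<exists>t'. \<forall>i. 0 \<le> i \<and> i < m \<longrightarrow> z (t + i) = C (t' + i)}"
  shows "ultimately_periodic_left C \<and> ultimately_periodic_right C"
proof
  let ?S = "\<lambda>C. {z. \<forall>t. \<exists>t'. \<forall>i. 0 \<le> i \<and> i < m \<longrightarrow> z (t + i) = (C (t' + i) :: 'c)}"
  have "?S (\<lambda>n. C (- n)) \<subseteq> (\<lambda>z n. z (- n)) ` ?S C"
  proof
    fix z assume z: "z \<in> ?S (\<lambda>n. C (- n))"
    have "(\<lambda>n. z (- n)) \<in> ?S C"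
    proof (intro CollectI allI)
      fix t
      obtain t' where t': "\<And>i. 0 \<le> i \<and> i < m \<Longrightarrow> z (- t - m + 1 + i) = C (- (t' + i))"
        using z by blast
      have "z (- (t + i)) = C (- t' - m + 1 + i)" if "0 \<le> i \<and> i < m" for i
        using t'[of "m - 1 - i"] that by (simp add: algebra_simps)
      then show "\<exists>t'. \<forall>i. 0 \<le> i \<and> i < m \<longrightarrow> z (- (t + i)) = C (t' + i)" by blast
    qed
    then show "z \<in> (\<lambda>z n. z (- n)) ` ?S C"
      by (intro image_eqI[of _ _ "\<lambda>n. z (- n)"]) simp_all
  qed
  then have "countable (?S (\<lambda>n. C (- n)))" using count by (meson countable_image countable_subset)
  moreover have "finite (range (\<lambda>n. C (- n)))" using fin by (rule finite_subset[rotated]) auto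
  ultimately show "ultimately_periodic_left C"
    unfolding ultimately_periodic_left_iff by (intro eventually_periodic_if_countably_many_splices)
  show "ultimately_periodic_right C"
    using assms by (rule eventually_periodic_if_countably_many_splices)
qed

section \<open>Local rules of covers\<close>

text \<open>An element \<open>(\<tau>, g)\<close> of \<open>L\<close> allows the symbol \<open>g\<close> of the image at a place where the
  preimage shows the pattern \<open>\<tau>\<close> on the window \<open>B\<close>.\<close>
definition obeys :: "(('g::ab_group_add \<Rightarrow> nat) \<times> 'a) set \<Rightarrow> 'g set \<Rightarrow> ('g \<Rightarrow> nat) \<Rightarrow> ('g \<Rightarrow> 'a) \<Rightarrow> 'g \<Rightarrow> bool"
  where "obeys L B x y v \<longleftrightarrow> (\<exists>a\<in>L. y v = snd a \<and> (\<forall>b\<in>B. x (v + b) = fst a b))"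

text \<open>The window collects the domains of the forbidden patterns, the window on which the block code
  depends, and the origin, which ensures that only symbols of the alphabet occur. The rule lists the
  window contents without a forbidden pattern at the origin that agree with some point of \<open>X\<close>
  where the block code looks, together with the symbol that the block code gives for that point.\<close>
lemma SFT_cover_local_rule:
  fixes X :: "('g::ab_group_add \<Rightarrow> nat) set"
  assumes cover: "SFT_cover A X \<Gamma> Y \<phi>"
  obtains B L where "finite B" "finite L" "0 \<in> B" "\<And>\<tau> g b. (\<tau>, g) \<in> L \<Longrightarrow> g \<in> \<Gamma> \<and> (b \<in> B \<longrightarrow> \<tau> b \<in> A)"
    "\<And>x y. x \<in> X \<and> \<phi> x = y \<longleftrightarrow> (\<forall>v. obeys L B x y v)"
proof -
  have bc: "block_code A X \<Gamma> Y \<phi>" and "SFT A X" using cover by (auto simp: SFT_cover_def)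
  then obtain F where F: "finite F" "F \<subseteq> patterns A" "X = avoiding A F" and X: "shift_space A X"
    by (auto simp: SFT_def)
  have "finite A" "finite \<Gamma>" using bc by (auto simp: block_code_def shift_space_def)
  obtain W where W: "finite W"
    "\<And>x x'. \<lbrakk>x \<in> X; x' \<in> X; \<forall>w\<in>W. x w = x' w\<rbrakk> \<Longrightarrow> \<phi> x 0 = \<phi> x' 0"
    using block_code_local[OF bc] by metis
  define B where "B = insert 0 (W \<union> \<Union>(dom ` F))"
  define L where "L = {(\<tau>, g). \<tau> \<in> B \<rightarrow>\<^sub>E A \<and> g \<in> \<Gamma> \<and> (\<forall>p\<in>F. \<exists>w\<in>dom p. p w \<noteq> Some (\<tau> w)) \<and>
      (\<exists>x\<in>X. (\<forall>w\<in>W. x w = \<tau> w) \<and> \<phi> x 0 = g)}"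
  have B: "finite B" "0 \<in> B" "W \<subseteq> B" "\<And>p. p \<in> F \<Longrightarrow> dom p \<subseteq> B"
    using W(1) F(1,2) by (auto simp: B_def patterns_def)
  have "L \<subseteq> (B \<rightarrow>\<^sub>E A) \<times> \<Gamma>" by (auto simp: L_def)
  then have L: "finite L"
    by (rule finite_subset) (intro finite_cartesian_product finite_PiE B \<open>finite A\<close> \<open>finite \<Gamma>\<close>)
  have phi: "\<phi> x v = \<phi> (shift v x) 0" if "x \<in> X" for x v
    using bc that by (simp add: block_code_def shift_def)
  have sh: "shift v x \<in> X" if "x \<in> X" for x v using X that by (simp add: shift_space_def)
  have phi_in: "\<phi> x v \<in> \<Gamma>" if "x \<in> X" for x v
    using cover that shift_space_range[of \<Gamma> Y "\<phi> x"] by (auto simp: SFT_cover_def block_code_def)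
  have iff: "x \<in> X \<and> \<phi> x = y \<longleftrightarrow> (\<forall>v. obeys L B x y v)" for x y
  proof (intro iffI allI)
    fix v assume x: "x \<in> X \<and> \<phi> x = y"
    let ?\<tau> = "restrict (\<lambda>b. x (v + b)) B"
    have "x w \<in> A" for w using shift_space_range[OF X, of x] x by auto
    moreover have "\<exists>w\<in>dom p. p w \<noteq> Some (?\<tau> w)" if p: "p \<in> F" for p
    proof -
      have "\<not> occurs_in p x" using x p F(3) by (auto simp: avoiding_def)
      then obtain w where "w \<in> dom p" "p w \<noteq> Some (x (v + w))" unfolding occurs_in_def by blast
      then show ?thesis using B(4)[OF p] by (intro bexI[of _ w]) auto
    qed
    moreover have "\<exists>x'\<in>X. (\<forall>w\<in>W. x' w = ?\<tau> w) \<and> \<phi> x' 0 = y v"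
      using x sh phi[of x v] B(3) by (intro bexI[of _ "shift v x"]) (auto simp: shift_def)
    ultimately have "(?\<tau>, y v) \<in> L" unfolding L_def using phi_in x by auto
    then show "obeys L B x y v" unfolding obeys_def by (intro bexI[of _ "(?\<tau>, y v)"]) auto
  next
    assume *: "\<forall>v. obeys L B x y v"
    have "\<exists>\<tau>. (\<tau>, y v) \<in> L \<and> (\<forall>b\<in>B. x (v + b) = \<tau> b)" for v
      using * unfolding obeys_def by fastforce
    then obtain \<tau> where \<tau>: "\<And>v. (\<tau> v, y v) \<in> L" "\<And>v b. b \<in> B \<Longrightarrow> x (v + b) = \<tau> v b" by metis
    have "x v \<in> A" for v
      using \<tau>(1)[of v] \<tau>(2)[OF B(2), of v] B(2) by (auto simp: L_def PiE_def Pi_def)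
    moreover have "\<not> occurs_in p x" if p: "p \<in> F" for p
    proof
      assume "occurs_in p x"
      then obtain v where v: "\<forall>w\<in>dom p. p w = Some (x (v + w))" unfolding occurs_in_def by blast
      obtain w where "w \<in> dom p" "p w \<noteq> Some (\<tau> v w)" using \<tau>(1)[of v] p unfolding L_def by blast
      then show False using v \<tau>(2)[of w v] B(4)[OF p] by auto
    qed
    ultimately have x: "x \<in> X" unfolding F(3) avoiding_def by auto
    have "\<phi> x v = y v" for v
    proof -
      have "\<exists>x'\<in>X. (\<forall>w\<in>W. x' w = \<tau> v w) \<and> \<phi> x' 0 = y v"
        using \<tau>(1)[of v] unfolding L_def by simp
      then obtain x' where x': "x' \<in> X" "\<forall>w\<in>W. x' w = \<tau> v w" "\<phi> x' 0 = y v"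
        by (elim bexE conjE)
      have "shift v x w = x' w" if "w \<in> W" for w
        using \<tau>(2)[of w v] x'(2) that subsetD[OF B(3) that] by (simp add: shift_def)
      then have "\<phi> (shift v x) 0 = \<phi> x' 0" by (intro W(2) sh x x'(1) ballI)
      then show ?thesis using x'(3) phi[OF x, of v] by simp
    qed
    with x show "x \<in> X \<and> \<phi> x = y" by auto
  qed
  show thesis
    by (rule that[OF B(1) L B(2) _ iff]) (auto simp: L_def)
qed

section \<open>Periodic configurations over a countable cover\<close>

text \<open>Used for the group of periods of a configuration: a configuration with period \<open>p\<close> along each
  vertical axis has all vertical periods that are multiples of \<open>p\<close>.\<close>
lemma mem_subgroup_generated_by_axes:
  fixes S :: "(int ^ 'd::finite) set"
  assumes S: "0 \<in> S" "\<And>u v. u \<in> S \<Longrightarrow> v \<in> S \<Longrightarrow> u + v \<in> S" "\<And>u. u \<in> S \<Longrightarrow> - u \<in> S"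
    and gen: "\<And>i. i \<noteq> h \<Longrightarrow> axis i p \<in> S"
    and u: "u $ h = 0" "\<And>i. i \<noteq> h \<Longrightarrow> p dvd u $ i"
  shows "u \<in> S"
proof -
  have mult: "axis i (p * k) \<in> S" if "i \<noteq> h" for i k
  proof (induction k rule: int_induct[of _ 0])
    case base
    have "axis i (p * 0) = (0 :: int ^ 'd)" by (simp add: axis_def vec_eq_iff)
    then show ?case using S(1) by metis
  next
    case (step1 k)
    have "axis i (p * (k + 1)) = (axis i (p * k) + axis i p :: int ^ 'd)"
      by (simp add: axis_def vec_eq_iff algebra_simps)
    then show ?case using S(2)[OF step1(2) gen[OF that]] by simp
  next
    case (step2 k)
    have "axis i (p * (k - 1)) = (axis i (p * k) + - axis i p :: int ^ 'd)"
      by (simp add: axis_def vec_eq_iff algebra_simps)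
    then show ?case using S(2)[OF step2(2) S(3)[OF gen[OF that]]] by simp
  qed
  have sum: "(\<Sum>i\<in>I. axis i (u $ i)) \<in> S" if "finite I" for I
    using that
  proof (induction I)
    case (insert i I)
    have "axis i (u $ i) \<in> S"
    proof (cases "i = h")
      case True
      then have "axis i (u $ i) = (0 :: int ^ 'd)" using u(1) by (simp add: axis_def vec_eq_iff)
      then show ?thesis using S(1) by metis
    next
      case False
      then show ?thesis using mult u(2)[OF False] by (auto elim!: dvdE)
    qed
    then show ?case using insert S(2) by simp
  qed (simp add: S(1))
  have "(\<Sum>i\<in>UNIV. axis i (u $ i)) = u"
    by (simp add: vec_eq_iff axis_def sum.delta' if_distrib cong: if_cong)
  then show ?thesis using sum[of UNIV] by simp
qed

lemma vertically_constant_eq: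
  fixes Y :: "(int ^ 'd::finite \<Rightarrow> 'a) set"
  assumes "vertically_constant h Y" "y \<in> Y" "v $ h = w $ h"
  shows "y v = y w"
proof -
  have "v - w \<in> {u. shift u y = y}"
  proof (rule mem_subgroup_generated_by_axes[where h = h and p = 1])
    fix u assume "u \<in> {u. shift u y = y}"
    then have "shift (- u) (shift u y) = shift (- u) y" by simp
    then show "- u \<in> {u. shift u y = y}" by (simp add: shift_add)
  next
    fix u v assume "u \<in> {u. shift u y = y}" "v \<in> {u. shift u y = y}"
    then show "u + v \<in> {u. shift u y = y}" using shift_add[of v u y] by simp
  qed (use assms in \<open>auto simp: vertically_constant_def\<close>)
  then have "shift (v - w) y w = y w" by simp
  then show ?thesis by (simp add: shift_def)
qed

definition set_h :: "'d::finite \<Rightarrow> int \<Rightarrow> int ^ 'd \<Rightarrow> int ^ 'd" where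
  "set_h h n v = (\<chi> i. if i = h then n else v $ i)"

lemma set_h_simps [simp]:
  "set_h h n v $ h = n" "set_h h (v $ h) v = v" "set_h h m (set_h h n v) = set_h h m v"
  "i \<noteq> h \<Longrightarrow> set_h h n v $ i = v $ i"
  by (auto simp: set_h_def vec_eq_iff)

lemma set_h_add: "set_h h n v + b = set_h h (n + b $ h) (v + b)"
  by (auto simp: set_h_def vec_eq_iff)

lemma eventually_periodic_mod:
  fixes C :: "int \<Rightarrow> 'c"
  assumes per: "\<And>n. n \<ge> N \<Longrightarrow> C n = C (n + p)" and ab: "a \<ge> N" "b \<ge> N" "p dvd a - b" "p > 0"
  shows "C a = C b"
proof -
  have *: "C n = C (n + p * int k)" if "n \<ge> N" for n k
  proof (induction k)
    case (Suc k)
    have "n + p * int k \<ge> N" using that ab(4) by (simp add: add_increasing2)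
    from per[OF this] Suc show ?case by (simp add: algebra_simps)
  qed simp
  have **: "C a = C b" if le: "a \<ge> N" "b \<ge> a" "p dvd b - a" for a b
  proof -
    obtain k where k: "b - a = p * k" using le(3) by (elim dvdE)
    moreover have "k \<ge> 0" using k le(2) ab(4) by (metis diff_ge_0_iff_ge zero_le_mult_iff not_less)
    ultimately have "b = a + p * int (nat k)" by simp
    then show ?thesis using *[OF le(1), of "nat k"] by metis
  qed
  have "p dvd b - a" using ab(3) by (rule dvd_diff_commute[THEN iffD1])
  then show ?thesis
    using **[OF ab(1)] **[OF ab(2)] ab(3) by (metis linear)
qed

text \<open>The points that \<open>fold_int q\<close> is meant to identify: same residue modulo \<open>q\<close>, and
  both on the same side outside of the interval from \<open>-q\<close> to \<open>q - 1\<close>.\<close>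
definition same_tail :: "nat \<Rightarrow> int \<Rightarrow> int \<Rightarrow> bool" where
  "same_tail q a b \<longleftrightarrow> a = b \<or> (int q \<le> a \<and> int q \<le> b \<or> a < - int q \<and> b < - int q) \<and> int q dvd a - b"

definition fold_invariant :: "'d::finite \<Rightarrow> nat \<Rightarrow> (int ^ 'd \<Rightarrow> 'b) \<Rightarrow> bool" where
  "fold_invariant h q x \<longleftrightarrow> (\<forall>v w. same_tail q (v $ h) (w $ h) \<and>
     (\<forall>i. i \<noteq> h \<longrightarrow> int q dvd v $ i - w $ i) \<longrightarrow> x v = x w)"

lemma finite_coordinate_bound:
  fixes B :: "(int ^ 'd::finite) set"
  assumes "finite B"
  obtains R where "R \<ge> 0" "\<And>b. b \<in> B \<Longrightarrow> \<bar>b $ h\<bar> \<le> R"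
  using assms
  by (intro that[of "\<Sum>b\<in>B. \<bar>b $ h\<bar>"] sum_nonneg) (auto intro: member_le_sum)

context
  fixes A :: "nat set" and X :: "(int ^ 'd::finite \<Rightarrow> nat) set" and \<Gamma> :: "'a set" and Y \<phi> h
  assumes cover: "SFT_cover A X \<Gamma> Y \<phi>" and count: "countable X" and vert: "vertically_constant h Y"
begin

text \<open>The finite orbit lemma for the fibre over \<open>z\<close> and the group of vertical translations; a
  common multiple of the periods along the axes serves as \<open>p\<close>.\<close>
lemma vertically_periodic_preimage:
  assumes z: "z \<in> Y"
  obtains x p where "x \<in> X" "\<phi> x = z" "p > 0" "\<And>i. i \<noteq> h \<Longrightarrow> shift (axis i p) x = x"
proof -
  have bc: "block_code A X \<Gamma> Y \<phi>" using cover by (simp add: SFT_cover_def)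
  have X: "finite A" "closedin (full_shift A) X" "\<And>v x. x \<in> X \<Longrightarrow> shift v x \<in> X"
    using bc by (auto simp: block_code_def shift_space_def)
  have top: "topspace (subtopology (full_shift A) X) = X" using closedin_subset[OF X(2)] by auto
  let ?M = "{x \<in> X. \<phi> x = z}"
  let ?V = "{v :: int ^ 'd. v $ h = 0}"
  obtain x where x: "x \<in> ?M" "finite ((\<lambda>v. shift v x) ` ?V)"
  proof (rule finite_orbit_in_countable_closed_set[of A ?M ?V])
    have cont: "continuous_map (subtopology (full_shift A) X) (full_shift \<Gamma>) \<phi>"
      using bc by (auto simp: block_code_def continuous_map_in_subtopology)
    have "z \<in> topspace (full_shift \<Gamma>)"
      using z bc shift_space_range[of \<Gamma> Y z] by (auto simp: block_code_def topspace_full_shift)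
    then have "closedin (full_shift \<Gamma>) {z}"
      by (simp add: closedin_Hausdorff_singleton Hausdorff_full_shift)
    from closedin_continuous_map_preimage[OF cont this]
    have "closedin (subtopology (full_shift A) X) ?M" unfolding top by simp
    then show "closedin (full_shift A) ?M" using X(2) closedin_trans_full by blast
    show "countable ?M" using count by (rule countable_subset[rotated]) auto
    show "?M \<noteq> {}" using z cover by (auto simp: SFT_cover_def)
  next
    fix v x assume v: "v \<in> ?V" and x: "x \<in> ?M"
    have "\<phi> (shift v x) = shift v z" using bc x by (auto simp: block_code_def)
    also have "\<dots> = z"
      by (rule ext, unfold shift_def, rule vertically_constant_eq[OF vert z]) (use v in simp)
    finally show "shift v x \<in> ?M" using X(3) x by auto
  qed (use X in auto)
  have "\<exists>p>0. shift (axis i p) x = x" if i: "i \<noteq> h" for i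
  proof -
    let ?s = "\<lambda>n::nat. shift (axis i (int n)) x"
    have "range ?s \<subseteq> (\<lambda>v. shift v x) ` ?V" using i by (auto simp: axis_def)
    then have "finite (range ?s)" using x(2) finite_subset by blast
    then have "\<not> inj ?s" using finite_imageD infinite_UNIV_nat by blast
    then obtain m n where "m < n" "?s m = ?s n" using linorder_injI[of ?s] by blast
    then have "shift (- axis i (int m)) (?s m) = shift (- axis i (int m)) (?s n)" by simp
    then have "x = shift (axis i (int n) + - axis i (int m)) x" by (simp add: shift_add)
    also have "axis i (int n) + - axis i (int m) = (axis i (int n - int m) :: int ^ 'd)"
      by (simp add: axis_def vec_eq_iff)
    finally show ?thesis using \<open>m < n\<close> by (intro exI[of _ "int n - int m"]) auto
  qed
  then obtain p where p: "\<And>i. i \<noteq> h \<Longrightarrow> p i > 0" "\<And>i. i \<noteq> h \<Longrightarrow> shift (axis i (p i)) x = x" by metis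
  define P where "P = (\<Prod>i\<in>UNIV - {h}. p i)"
  have "P > 0" unfolding P_def using p(1) by (intro prod_pos) auto
  moreover have "shift (axis i P) x = x" if i: "i \<noteq> h" for i
  proof -
    have "p i dvd P" unfolding P_def using i by (intro dvd_prodI) auto
    then obtain k where k: "P = p i * k" by (elim dvdE)
    moreover have "k \<ge> 0" using k \<open>P > 0\<close> p(1)[OF i] by (simp add: zero_less_mult_iff)
    ultimately have "P = p i * int (nat k)" by simp
    moreover have "shift (axis i (p i * int n)) x = x" for n
    proof (induction n)
      case 0
      have "axis i (p i * int 0) = (0 :: int ^ 'd)" by (simp add: axis_def vec_eq_iff)
      then show ?case by (metis shift_0)
    next
      case (Suc n)
      have "axis i (p i * int (Suc n)) = (axis i (p i) + axis i (p i * int n) :: int ^ 'd)"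
        by (simp add: axis_def vec_eq_iff algebra_simps)
      then have "shift (axis i (p i * int (Suc n))) x
          = shift (axis i (p i * int n)) (shift (axis i (p i)) x)"
        by (simp only: shift_add)
      then show ?case using p(2)[OF i] Suc by (simp only:)
    qed
    ultimately show ?thesis by metis
  qed
  ultimately show thesis using that x(1) by blast
qed

lemma vertical_period:
  fixes x :: "int ^ 'd \<Rightarrow> nat"
  assumes p: "\<And>i. i \<noteq> h \<Longrightarrow> shift (axis i p) x = x"
    and vw: "v $ h = w $ h" "\<And>i. i \<noteq> h \<Longrightarrow> p dvd v $ i - w $ i"
  shows "x v = x w"
proof -
  have "v - w \<in> {u. shift u x = x}"
  proof (rule mem_subgroup_generated_by_axes[where h = h and p = p])
    fix u assume "u \<in> {u. shift u x = x}"
    then have "shift (- u) (shift u x) = shift (- u) x" by simp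
    then show "- u \<in> {u. shift u x = x}" by (simp add: shift_add)
  next
    fix u v assume "u \<in> {u. shift u x = x}" "v \<in> {u. shift u x = x}"
    then show "u + v \<in> {u. shift u x = x}" using shift_add[of v u x] by simp
  qed (use assms in auto)
  then have "shift (v - w) x w = x w" by simp
  then show ?thesis by (simp add: shift_def)
qed

text \<open>Column \<open>n\<close> is kept as a function of the whole lattice that ignores the horizontal
  coordinate of its argument. By vertical periodicity there are finitely many columns. A sequence of
  columns all of whose windows of length \<open>2 * R + 1\<close> occur in \<open>x\<close>, where \<open>R\<close> is the horizontal
  radius of the local rule, is again a point of \<open>X\<close>, and different sequences
  give different points. So there are countably many of them.\<close>
lemma columns_ultimately_periodic:
  assumes x: "x \<in> X" and p: "p > 0" "\<And>i. i \<noteq> h \<Longrightarrow> shift (axis i p) x = x"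
  defines "C \<equiv> \<lambda>n v. x (set_h h n v)"
  shows "ultimately_periodic_left C \<and> ultimately_periodic_right C"
proof -
  obtain B L where "finite B" and rule: "\<And>x y. x \<in> X \<and> \<phi> x = y \<longleftrightarrow> (\<forall>v. obeys L B x y v)"
    using SFT_cover_local_rule[OF cover] by metis
  obtain R where "R \<ge> 0" and R: "\<And>b. b \<in> B \<Longrightarrow> \<bar>b $ h\<bar> \<le> R"
    using finite_coordinate_bound[OF \<open>finite B\<close>, of h] by blast
  show ?thesis
  proof (rule ultimately_periodic_if_countably_many_splices[where m = "2 * R + 1"])
    let ?box = "{v :: int ^ 'd. \<forall>i. v $ i \<in> {0..<p}}"
    have box: "finite ?box"
    proof -
      have "?box \<subseteq> (\<lambda>f. \<chi> i. f i) ` (UNIV \<rightarrow>\<^sub>E {0..<p})"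
      proof
        fix v assume "v \<in> ?box"
        then show "v \<in> (\<lambda>f. \<chi> i. f i) ` (UNIV \<rightarrow>\<^sub>E {0..<p})"
          by (intro image_eqI[of _ _ "\<lambda>i. v $ i"]) auto
      qed
      then show ?thesis by (rule finite_subset) (intro finite_imageI finite_PiE, auto)
    qed
    have A: "finite A" "\<And>v. x v \<in> A"
      using cover x shift_space_range[of A X x]
      by (auto simp: SFT_cover_def block_code_def shift_space_def)
    \<comment> \<open>a column is determined by its values on one vertical period\<close>
    show "finite (range C)"
    proof (rule inj_on_finite[of "\<lambda>c. restrict c ?box" _ "?box \<rightarrow>\<^sub>E A"])
      show "inj_on (\<lambda>c. restrict c ?box) (range C)"
      proof (rule inj_onI)
        fix c d assume "c \<in> range C" "d \<in> range C" and eq: "restrict c ?box = restrict d ?box"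
        then obtain m n where mn: "c = C m" "d = C n" by blast
        have red: "C n v = C n (\<chi> i. v $ i mod p)" for n v
          unfolding C_def using p(2) by (rule vertical_period) (auto simp: mod_eq_dvd_iff[symmetric])
        have "c v = d v" for v
        proof -
          have "(\<chi> i. v $ i mod p) \<in> ?box" using p(1) by simp
          then have "c (\<chi> i. v $ i mod p) = d (\<chi> i. v $ i mod p)"
            using fun_cong[OF eq, of "\<chi> i. v $ i mod p"] by (simp only: restrict_apply if_True)
          then show ?thesis unfolding mn by (simp only: red[of _ v])
        qed
        then show "c = d" by blast
      qed
      show "finite (?box \<rightarrow>\<^sub>E A)" using box A(1) by (intro finite_PiE) auto
      show "(\<lambda>c. restrict c ?box) ` range C \<subseteq> ?box \<rightarrow>\<^sub>E A"
        using A(2) unfolding image_subset_iff restrict_PiE_iff by (auto simp: C_def)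
    qed
  next
    let ?Z = "{z. \<forall>t. \<exists>t'. \<forall>i. 0 \<le> i \<and> i < 2 * R + 1 \<longrightarrow> z (t + i) = C (t' + i)}"
    have obx: "\<And>v. obeys L B x (\<phi> x) v" using rule x by blast
    have "?Z \<subseteq> (\<lambda>x n v. x (set_h h n v)) ` X"
    proof
      fix z assume z: "z \<in> ?Z"
      then obtain T where T: "\<And>t i. 0 \<le> i \<Longrightarrow> i < 2 * R + 1 \<Longrightarrow> z (t + i) = C (T t + i)"
        by (auto simp: all_conj_distrib) metis
      let ?x = "\<lambda>v. z (v $ h) v"
      let ?src = "\<lambda>v. set_h h (T (v $ h - R) + R) v"
      have "obeys L B ?x (\<lambda>v. \<phi> x (?src v)) v" for v
      proof -
        have "?x (v + b) = x (?src v + b)" if "b \<in> B" for b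
        proof -
          have "z ((v $ h - R) + (R + b $ h)) = C (T (v $ h - R) + (R + b $ h))"
            using R[OF that] by (intro T) auto
          then have "z ((v + b) $ h) = C (T (v $ h - R) + R + b $ h)" by (simp add: add.assoc)
          then show ?thesis by (simp add: C_def set_h_add)
        qed
        then show ?thesis using obx[of "?src v"] unfolding obeys_def by auto
      qed
      then have xX: "?x \<in> X" using rule by blast
      have zx: "z = (\<lambda>n v. ?x (set_h h n v))"
      proof (intro ext)
        fix n v
        have "z n = C (T (n - R) + R)" using T[of R "n - R"] \<open>R \<ge> 0\<close> by simp
        then show "z n v = ?x (set_h h n v)" by (simp add: C_def)
      qed
      show "z \<in> (\<lambda>x n v. x (set_h h n v)) ` X"
        by (rule image_eqI[where x = ?x]) (fact zx, fact xX)
    qed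
    then show "countable ?Z" using countable_image[OF count] by (rule countable_subset)
  qed
qed

text \<open>One number \<open>q\<close> serves as vertical period, as period of both horizontal ends, and as the
  distance from the origin where these ends begin. It may be any sufficiently divisible number;
  the divisor \<open>r\<close> lets later arguments impose further conditions on it.\<close>
lemma fold_invariant_preimage:
  assumes z: "z \<in> Y" and r: "r > 0"
  obtains x q where "x \<in> X" "\<phi> x = z" "q > 0" "r dvd q" "fold_invariant h q x"
proof -
  obtain x p where x: "x \<in> X" "\<phi> x = z" "p > 0" and per: "\<And>i. i \<noteq> h \<Longrightarrow> shift (axis i p) x = x"
    using vertically_periodic_preimage[OF z] by metis
  define C where "C = (\<lambda>n v. x (set_h h n v))"
  have "ultimately_periodic_left C" "ultimately_periodic_right C"
    using columns_ultimately_periodic[OF x(1,3) per] unfolding C_def by simp_all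
  then obtain pr Nr pl Nl where pr: "pr > 0" "\<And>n. n \<ge> Nr \<Longrightarrow> C n = C (n + pr)"
    and pl: "pl > 0" "\<And>n. n \<le> Nl \<Longrightarrow> C n = C (n - pl)"
    unfolding ultimately_periodic_left_def ultimately_periodic_right_def by metis
  define M where "M = 1 + \<bar>Nr\<bar> + \<bar>Nl\<bar>"
  define q where "q = r * nat (p * (pr * (pl * M)))"
  have pos: "p * (pr * (pl * M)) > 0" using x(3) pr(1) pl(1) by (simp add: M_def)
  then have q: "int q = int r * (p * (pr * (pl * M)))" by (simp add: q_def)
  have qpos: "q > 0" using pos r by (simp add: q_def)
  have dvd: "p dvd int q" "pr dvd int q" "pl dvd int q" "M dvd int q" unfolding q by simp_all
  have qM: "int q \<ge> M" using dvd(4) qpos by (intro zdvd_imp_le) auto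
  have Ceq: "C a = C b" if "same_tail q a b" for a b
    using that unfolding same_tail_def
  proof (elim disjE conjE)
    assume ab: "int q \<le> a" "int q \<le> b" "int q dvd a - b"
    show ?thesis
    proof (rule eventually_periodic_mod[where N = Nr and p = pr])
      show "pr dvd a - b" using dvd(2) ab(3) by (rule dvd_trans)
    qed (use pr(1) qM ab in \<open>auto simp: M_def intro: pr(2)\<close>)
  next
    assume ab: "a < - int q" "b < - int q" "int q dvd a - b"
    have "C (- (- a)) = C (- (- b))"
    proof (rule eventually_periodic_mod[where C = "\<lambda>n. C (- n)" and N = "- Nl" and p = pl])
      show "C (- n) = C (- (n + pl))" if "n \<ge> - Nl" for n using pl(2)[of "- n"] that by simp
      show "pl dvd - a - - b" using dvd_diff_commute[THEN iffD1, OF dvd_trans[OF dvd(3) ab(3)]] by simp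
    qed (use pl(1) qM ab in \<open>auto simp: M_def\<close>)
    then show ?thesis by simp
  qed simp
  have "x v = x w" if "same_tail q (v $ h) (w $ h)" "\<And>i. i \<noteq> h \<Longrightarrow> int q dvd v $ i - w $ i" for v w
  proof -
    have "x v = C (v $ h) v" by (simp add: C_def)
    also have "\<dots> = C (w $ h) v" using Ceq[OF that(1)] by simp
    also have "\<dots> = x (set_h h (w $ h) v)" by (simp add: C_def)
    also have "\<dots> = x w"
      using per by (rule vertical_period) (use that(2) dvd(1) in \<open>auto intro: dvd_trans\<close>)
    finally show ?thesis .
  qed
  then have "fold_invariant h q x" unfolding fold_invariant_def by blast
  moreover have "r dvd q" by (simp add: q_def)
  ultimately show thesis by (intro that[OF x(1,2) qpos])
qed

text \<open>If \<open>x\<close> shows the same window content at \<open>v\<close> and at \<open>w\<close>, then \<open>z\<close> has the same symbol at both: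
  otherwise the symbol at \<open>w\<close> could be changed to the one at \<open>v\<close> without violating the local
  rule, and \<open>x\<close> would have two images. So \<open>z\<close> inherits the periodicity of \<open>x\<close>.\<close>
lemma image_ultimately_periodic:
  assumes z: "z \<in> Y"
  shows "ultimately_periodic_left (\<lambda>n. z (axis h n)) \<and> ultimately_periodic_right (\<lambda>n. z (axis h n))"
proof -
  obtain B L where "finite B" and rule: "\<And>x y. x \<in> X \<and> \<phi> x = y \<longleftrightarrow> (\<forall>v. obeys L B x y v)"
    using SFT_cover_local_rule[OF cover] by metis
  obtain R where "R \<ge> 0" and R: "\<And>b. b \<in> B \<Longrightarrow> \<bar>b $ h\<bar> \<le> R"
    using finite_coordinate_bound[OF \<open>finite B\<close>, of h] by blast
  obtain x q where x: "x \<in> X" "\<phi> x = z" "q > 0" "1 dvd q" "fold_invariant h q x"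
    using fold_invariant_preimage[OF z, of 1] by auto
  have ob: "obeys L B x z v" for v using rule x by blast
  have eq: "z v = z w" if vw: "\<And>b. b \<in> B \<Longrightarrow> x (v + b) = x (w + b)" for v w
  proof -
    \<comment> \<open>at \<open>w\<close> the list element used at \<open>v\<close> still fits\<close>
    have "obeys L B x (z(w := z v)) u" for u
      using ob[of u] ob[of v] vw by (auto simp: obeys_def)
    then have "\<phi> x = z(w := z v)" using rule by blast
    then show ?thesis using x(2) by (metis fun_upd_same)
  qed
  have st: "z (axis h m) = z (axis h n)" if "\<And>b. b \<in> B \<Longrightarrow> same_tail q (m + b $ h) (n + b $ h)" for m n
  proof (rule eq)
    fix b assume "b \<in> B"
    then show "x (axis h m + b) = x (axis h n + b)"
      using x(5) that[of b] unfolding fold_invariant_def by (simp add: axis_def)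
  qed
  have "z (axis h n) = z (axis h (n + int q))" if "n \<ge> int q + R" for n
    using R that by (intro st) (force simp: same_tail_def)
  moreover have "z (axis h n) = z (axis h (n - int q))" if "n \<le> - int q - R - 1" for n
    using R that by (intro st) (force simp: same_tail_def)
  moreover have "int q > 0" using x(3) by simp
  ultimately show ?thesis unfolding ultimately_periodic_left_def ultimately_periodic_right_def by blast
qed

end

section \<open>Finite certificates\<close>

text \<open>A finite configuration over the alphabet \<open>{..<S}\<close> is stored as a number in base \<open>S\<close>.
  So the configurations on \<open>N\<close> places are the numbers below \<open>S ^ N\<close>, and a
  search through all of them is a bounded quantifier.\<close>
definition digit :: "nat \<Rightarrow> nat \<Rightarrow> nat \<Rightarrow> nat" where
  "digit S c i = c div S ^ i mod S"

lemma digit_less: "S > 0 \<Longrightarrow> digit S c i < S"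
  by (simp add: digit_def)

lemma ex_digits:
  assumes "\<And>i. i < N \<Longrightarrow> f i < S"
  shows "\<exists>c<S ^ N. \<forall>i<N. digit S c i = f i"
  using assms
proof (induction N arbitrary: f)
  case (Suc N)
  obtain c where c: "c < S ^ N" "\<And>i. i < N \<Longrightarrow> digit S c i = f (Suc i)"
    using Suc.IH[of "\<lambda>i. f (Suc i)"] Suc.prems by auto
  have f0: "f 0 < S" using Suc.prems by simp
  let ?c = "f 0 + S * c"
  have "?c < S * (1 + c)" using f0 by simp
  also have "\<dots> \<le> S * S ^ N" using c(1) by (intro mult_le_mono) auto
  finally have "?c < S ^ Suc N" by simp
  moreover have "digit S ?c i = f i" if "i < Suc N" for i
  proof (cases i)
    case 0
    then show ?thesis using f0 by (simp add: digit_def)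
  next
    case (Suc j)
    have "?c div (S * S ^ j) = c div S ^ j" using f0 by (simp add: div_mult2_eq)
    then show ?thesis using c(2)[of j] that Suc by (simp add: digit_def)
  qed
  ultimately show ?case by blast
qed simp

lemma computable_digit [computable_intros]:
  assumes "computable k c" "computable k i"
  shows "computable k (\<lambda>xs. digit S (c xs) (i xs))"
  unfolding digit_def by (intro computable_intros assms)

text \<open>The value \<open>x k\<close> is chosen as one that occurs at place \<open>k\<close> infinitely often among the
  sequences that agree with \<open>x\<close> up to \<open>k\<close>.\<close>
lemma koenig:
  fixes f :: "nat \<Rightarrow> nat \<Rightarrow> nat"
  assumes f: "\<And>N i. f N i < S"
  obtains x where "\<And>k. infinite {N. \<forall>i<k. f N i = x i}"
proof -
  have step: "\<exists>a. infinite {N \<in> M. f N k = a}" if "infinite M" for M k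
  proof -
    have "finite ((\<lambda>N. f N k) ` M)"
      by (rule finite_subset[of _ "{..<S}"]) (auto intro: f)
    then show ?thesis using pigeonhole_infinite[OF that, of "\<lambda>N. f N k"] by auto
  qed
  define next_set where "next_set = (\<lambda>k M. {N \<in> M. f N k = (SOME a. infinite {N \<in> M. f N k = a})})"
  define Ms where "Ms = rec_nat UNIV next_set"
  define x where "x = (\<lambda>k. SOME a. infinite {N \<in> Ms k. f N k = a})"
  have Suc: "Ms (Suc k) = {N \<in> Ms k. f N k = x k}" for k by (simp add: Ms_def next_set_def x_def)
  have "infinite (Ms k) \<and> Ms k = {N. \<forall>i<k. f N i = x i}" for k
  proof (induction k)
    case 0
    show ?case by (simp add: Ms_def)
  next
    case (Suc k)
    have "infinite {N \<in> Ms k. f N k = x k}"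
      unfolding x_def by (rule someI_ex) (use step Suc in blast)
    then show ?case unfolding \<open>Ms (Suc k) = _\<close> using Suc by (auto simp: less_Suc_eq)
  qed
  then show thesis using that by metis
qed

definition column :: "'d::finite \<Rightarrow> nat \<Rightarrow> nat" where
  "column h n = int_encode ((pos_decode n :: int ^ 'd) $ h)"

text \<open>No assignment of symbols to the first \<open>N\<close> places obeys the local rule at those places among
  them whose whole window lies among them. Here \<open>s g m\<close> states that the configuration to be covered has
  the symbol \<open>g\<close> in the column whose number is coded by \<open>m\<close>; it may be a partial
  description of a configuration.\<close>
definition blocked :: "((int ^ 'd::finite \<Rightarrow> nat) \<times> 'a) set \<Rightarrow> (int ^ 'd) set \<Rightarrow> nat \<Rightarrow> 'd \<Rightarrow>
    nat \<Rightarrow> ('a \<Rightarrow> nat \<Rightarrow> bool) \<Rightarrow> bool" where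
  "blocked L B S h N s \<longleftrightarrow> (\<forall>c<S ^ N. \<exists>n<N. (\<forall>b\<in>B. pos_code (pos_decode n + b) < N) \<and>
     \<not> (\<exists>a\<in>L. s (snd a) (column h n) \<and> (\<forall>b\<in>B. digit S c (pos_code (pos_decode n + b)) = fst a b)))"

text \<open>The symbols stored in \<open>c\<close>, spread over the lattice along the folding, obey the local rule in
  a box. The inner \<open>pos_code\<close> and \<open>pos_decode\<close> cancel; they keep the expression in the form
  of a composition of computable functions on codes.\<close>
definition certified :: "((int ^ 'd::finite \<Rightarrow> nat) \<times> 'a) set \<Rightarrow> (int ^ 'd) set \<Rightarrow> nat \<Rightarrow> 'd \<Rightarrow>
    nat \<Rightarrow> nat \<Rightarrow> ('a \<Rightarrow> nat \<Rightarrow> bool) \<Rightarrow> bool" where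
  "certified L B S h q c s \<longleftrightarrow> (\<forall>n<box_bound TYPE('d) q. \<exists>a\<in>L. s (snd a) (column h n) \<and>
     (\<forall>b\<in>B. digit S c (pos_code (fold_pos h q (pos_decode (pos_code (pos_decode n + b))))) = fst a b))"

lemma not_blocked_if_obeys:
  assumes x: "\<And>v. obeys L B x z v" "\<And>v. x v < S"
    and s: "\<And>n. n < N \<Longrightarrow> s (z (pos_decode n)) (column h n)"
  shows "\<not> blocked L B S h N s"
proof -
  obtain c where c: "c < S ^ N" "\<And>i. i < N \<Longrightarrow> digit S c i = x (pos_decode i)"
    using ex_digits[of N "\<lambda>i. x (pos_decode i)" S] x(2) by blast
  have "\<exists>a\<in>L. s (snd a) (column h n) \<and> (\<forall>b\<in>B. digit S c (pos_code (pos_decode n + b)) = fst a b)"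
    if "n < N" "\<forall>b\<in>B. pos_code (pos_decode n + b) < N" for n
  proof -
    obtain a where "a \<in> L" "z (pos_decode n) = snd a" "\<forall>b\<in>B. x (pos_decode n + b) = fst a b"
      using x(1)[of "pos_decode n"] unfolding obeys_def by blast
    then show ?thesis using s[OF that(1)] c(2) that(2) by (intro bexI[of _ a]) auto
  qed
  then show ?thesis using c(1) unfolding blocked_def by blast
qed

text \<open>Koenig's lemma glues the finite assignments together: the rule at a given place involves finitely
  many places only, and some assignment agrees with the limit on all of them.\<close>
lemma obeys_if_never_blocked:
  fixes h :: "'d::finite" and z :: "int ^ 'd \<Rightarrow> 'a"
  assumes "finite B" "S > 0" and nb: "\<And>N. \<not> blocked L B S h N s"
    and s: "\<And>a n. a \<in> L \<Longrightarrow> s (snd a) (column h n) \<Longrightarrow> z (pos_decode n) = snd a"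
  obtains x where "\<And>v. obeys L B x z v"
proof -
  have "\<exists>c. \<forall>n<N. (\<forall>b\<in>B. pos_code (pos_decode n + b) < N) \<longrightarrow>
     (\<exists>a\<in>L. s (snd a) (column h n) \<and> (\<forall>b\<in>B. digit S c (pos_code (pos_decode n + b)) = fst a b))" for N
    using nb[of N] unfolding blocked_def by blast
  then obtain c where c: "\<And>N n. n < N \<Longrightarrow> (\<forall>b\<in>B. pos_code (pos_decode n + b) < N) \<Longrightarrow>
     (\<exists>a\<in>L. s (snd a) (column h n) \<and> (\<forall>b\<in>B. digit S (c N) (pos_code (pos_decode n + b)) = fst a b))"
    by metis
  obtain \<xi> where \<xi>: "\<And>k. infinite {N. \<forall>i<k. digit S (c N) i = \<xi> i}"
    using koenig[of "\<lambda>N. digit S (c N)" S] digit_less[OF \<open>S > 0\<close>] by blast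
  have "obeys L B (\<lambda>v. \<xi> (pos_code v)) z v" for v
  proof -
    let ?I = "insert (pos_code v) ((\<lambda>b. pos_code (v + b)) ` B)"
    obtain k where k: "\<forall>i\<in>?I. i < k"
      using \<open>finite B\<close> finite_nat_set_iff_bounded[of ?I] by auto
    obtain N where N: "N > k" "\<forall>i<k. digit S (c N) i = \<xi> i"
      using \<xi>[of k] by (auto simp: infinite_nat_iff_unbounded)
    obtain a where a: "a \<in> L" "s (snd a) (column h (pos_code v))"
      "\<forall>b\<in>B. digit S (c N) (pos_code (v + b)) = fst a b"
    proof -
      have "pos_code v < N" "\<forall>b\<in>B. pos_code (v + b) < N"
        using k N(1) by (auto intro: less_trans)
      then show thesis using c[of "pos_code v" N] that by auto
    qed
    have "\<xi> (pos_code (v + b)) = fst a b" if "b \<in> B" for b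
    proof -
      have "pos_code (v + b) < k" using k that by blast
      then show ?thesis using N(2) a(3) that by metis
    qed
    moreover have "z v = snd a" using s[OF a(1,2)] by simp
    ultimately show ?thesis unfolding obeys_def using a(1) by (intro bexI[of _ a]) auto
  qed
  then show thesis by (rule that)
qed

lemma fold_int_same_tail:
  assumes "q > 0" "same_tail q a b" shows "fold_int q a = fold_int q b"
  using assms(2) unfolding same_tail_def
proof (elim disjE conjE)
  assume "int q \<le> a" "int q \<le> b" "int q dvd a - b"
  then show ?thesis by (simp add: fold_int_def mod_eq_dvd_iff)
next
  assume ab: "a < - int q" "b < - int q" "int q dvd a - b"
  have "int q dvd (- a - 1) - (- b - 1)" using ab(3) dvd_diff_commute[of "int q" a b] by simp
  then have "(- a - 1) mod int q = (- b - 1) mod int q" by (simp only: mod_eq_dvd_iff)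
  then show ?thesis using ab assms(1) by (simp add: fold_int_def)
qed simp

lemma same_tail_fold_int:
  assumes "q > 0" shows "same_tail q (fold_int q i) i"
proof -
  consider "- int q \<le> i \<and> i < int q" | "i \<ge> int q" | "i < - int q" by linarith
  then show ?thesis
  proof cases
    case 2
    have "int q dvd i mod int q - i" by (simp add: mod_eq_dvd_iff[symmetric])
    then have "int q dvd int q + (i mod int q - i)" by (rule dvd_add[OF dvd_refl])
    moreover have "0 \<le> i mod int q" using assms by simp
    ultimately show ?thesis using 2 by (simp add: same_tail_def fold_int_def add_diff_eq)
  next
    case 3
    have "int q dvd (- i - 1) - (- i - 1) mod int q" by (simp only: mod_eq_dvd_iff[symmetric] mod_mod_trivial)
    then have "int q dvd ((- i - 1) - (- i - 1) mod int q) - int q" by (rule dvd_diff[OF _ dvd_refl])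
    moreover have "((- i - 1) - (- i - 1) mod int q) - int q = - int q - 1 - (- i - 1) mod int q - i"
      by simp
    moreover have "0 \<le> (- i - 1) mod int q" using assms by simp
    ultimately show ?thesis using 3 by (simp add: same_tail_def fold_int_def)
  qed (simp add: same_tail_def fold_int_def)
qed

lemma fold_pos_cong:
  assumes "q > 0" "same_tail q (v $ h) (w $ h)" "\<And>i. i \<noteq> h \<Longrightarrow> int q dvd v $ i - w $ i"
  shows "fold_pos h q v = fold_pos h q w"
  using assms(3) fold_int_same_tail[OF assms(1,2)]
  by (simp add: fold_pos_def vec_eq_iff mod_eq_dvd_iff)

lemma fold_invariant_fold_pos:
  assumes "fold_invariant h q x" "q > 0"
  shows "x (fold_pos h q v) = x v"
proof -
  have "same_tail q (fold_pos h q v $ h) (v $ h)"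
    using same_tail_fold_int[OF assms(2)] by (simp add: fold_pos_def)
  moreover have "int q dvd fold_pos h q v $ i - v $ i" if "i \<noteq> h" for i
    using that by (simp add: fold_pos_def mod_eq_dvd_iff[symmetric])
  ultimately show ?thesis using assms(1) unfolding fold_invariant_def by blast
qed

text \<open>Every place is equivalent to one in the box of radius \<open>3 * q\<close> in such a way that places
  shifted by at most \<open>q\<close> are still equivalent. Places that are moved horizontally end
  up at a distance of more than \<open>q\<close> from the part of the axis where the folding is not periodic, which gives room for the window.\<close>
lemma box_representative:
  assumes "q > 0"
  obtains w :: "int ^ 'd::finite" where "\<And>i. \<bar>w $ i\<bar> \<le> 3 * int q"
    "\<And>i. i \<noteq> h \<Longrightarrow> int q dvd v $ i - w $ i"
    "\<And>b. \<bar>b\<bar> \<le> int q \<Longrightarrow> same_tail q (v $ h + b) (w $ h + b)"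
proof
  define r where "r = (\<lambda>i. if i > 3 * int q then 2 * int q + i mod int q
     else if i < - 3 * int q then - 3 * int q + i mod int q else i)"
  let ?w = "\<chi> i. if i = h then r (v $ h) else v $ i mod int q"
  have m: "0 \<le> i mod int q" "i mod int q < int q" "int q dvd i - i mod int q" for i
    using assms by (simp_all add: mod_eq_dvd_iff[symmetric])
  have "i mod int q \<le> 3 * int q" for i using m(2)[of i] by linarith
  then show "\<bar>?w $ i\<bar> \<le> 3 * int q" for i
    using m(1)[of "v $ i"] m(1,2)[of "v $ h"] by (cases "i = h") (simp_all add: r_def abs_le_iff)
  show "int q dvd v $ i - ?w $ i" if "i \<noteq> h" for i using that m(3) by simp
  show "same_tail q (v $ h + b) (?w $ h + b)" if b: "\<bar>b\<bar> \<le> int q" for b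
  proof -
    have "int q dvd (v $ h - v $ h mod int q) - 2 * int q" "int q dvd (v $ h - v $ h mod int q) + 3 * int q"
      by (rule dvd_diff[OF m(3)] dvd_add[OF m(3)], simp)+
    then obtain k where "0 \<le> k" "k < int q"
      "r (v $ h) = (if v $ h > 3 * int q then 2 * int q + k
        else if v $ h < - 3 * int q then - 3 * int q + k else v $ h)"
      "int q dvd v $ h - (2 * int q + k)" "int q dvd v $ h - (- 3 * int q + k)"
      using m(1,2)[of "v $ h"] that[of "v $ h mod int q"] by (simp add: r_def algebra_simps)
    then show ?thesis using b by (auto simp: same_tail_def)
  qed
qed

text \<open>A configuration that is constant on the fibres of the folding sees in the box all windows that
  it has, so the check in the box is enough.\<close>
lemma obeys_if_certified:
  fixes h :: "'d::finite" and z :: "int ^ 'd \<Rightarrow> 'a"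
  assumes q: "q > 0" "\<And>b. b \<in> B \<Longrightarrow> \<bar>b $ h\<bar> \<le> int q" and z: "fold_invariant h q z"
    and s: "\<And>a n. a \<in> L \<Longrightarrow> s (snd a) (column h n) \<Longrightarrow> z (pos_decode n) = snd a"
    and c: "certified L B S h q c s"
  obtains x where "\<And>v. obeys L B x z v"
proof -
  let ?x = "\<lambda>v. digit S c (pos_code (fold_pos h q v))"
  have "obeys L B ?x z v" for v
  proof -
    obtain w :: "int ^ 'd" where w: "\<And>i. \<bar>w $ i\<bar> \<le> 3 * int q"
      "\<And>i. i \<noteq> h \<Longrightarrow> int q dvd v $ i - w $ i"
      "\<And>b. \<bar>b\<bar> \<le> int q \<Longrightarrow> same_tail q (v $ h + b) (w $ h + b)"
      using box_representative[OF q(1), of h v] by blast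
    have "pos_code w < box_bound TYPE('d) q" using w(1) by (rule pos_code_less_box_bound)
    then obtain a where a: "a \<in> L" "s (snd a) (column h (pos_code w))" "\<forall>b\<in>B. ?x (w + b) = fst a b"
      using c unfolding certified_def by force
    have "?x (v + b) = fst a b" if "b \<in> B" for b
    proof -
      have "fold_pos h q (v + b) = fold_pos h q (w + b)"
        by (rule fold_pos_cong[OF q(1)]) (use w(2,3) q(2)[OF that] in auto)
      then show ?thesis using a(3) that by simp
    qed
    moreover have "z v = snd a"
    proof -
      have "z v = z w"
        using z w(2) w(3)[of 0] unfolding fold_invariant_def by simp
      then show ?thesis using s[OF a(1,2)] by simp
    qed
    ultimately show ?thesis unfolding obeys_def using a(1) by (intro bexI[of _ a]) auto
  qed
  then show thesis by (rule that)
qed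

lemma certified_if_obeys:
  fixes h :: "'d::finite" and z :: "int ^ 'd \<Rightarrow> 'a"
  assumes x: "\<And>v. obeys L B x z v" "\<And>v. x v < S" "fold_invariant h q x" and q: "q > 0" and B: "finite B"
    and s: "\<And>n. s (z (pos_decode n)) (column h n)"
  obtains c where "certified L B S h q c s"
proof -
  let ?I = "(\<lambda>(n, b). pos_code (fold_pos h q (pos_decode n + b))) ` ({..<box_bound TYPE('d) q} \<times> B)"
  have "finite ?I" using B by simp
  then obtain N where N: "\<forall>i\<in>?I. i < N"
    using finite_nat_set_iff_bounded[of ?I] by blast
  obtain c where c: "\<And>i. i < N \<Longrightarrow> digit S c i = x (pos_decode i)"
    using ex_digits[of N "\<lambda>i. x (pos_decode i)" S] x(2) by blast
  have "certified L B S h q c s"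
    unfolding certified_def
  proof (intro allI impI)
    fix n assume n: "n < box_bound TYPE('d) q"
    obtain \<tau> where \<tau>: "(\<tau>, z (pos_decode n)) \<in> L" "\<And>b. b \<in> B \<Longrightarrow> x (pos_decode n + b) = \<tau> b"
      using x(1)[of "pos_decode n"] unfolding obeys_def by (metis prod.collapse)
    have "digit S c (pos_code (fold_pos h q (pos_decode n + b))) = \<tau> b" if "b \<in> B" for b
    proof -
      have "pos_code (fold_pos h q (pos_decode n + b)) < N" using N n that by force
      then show ?thesis using c fold_invariant_fold_pos[OF x(3) q] \<tau>(2)[OF that] by simp
    qed
    then show "\<exists>a\<in>L. s (snd a) (column h n) \<and>
       (\<forall>b\<in>B. digit S c (pos_code (fold_pos h q (pos_decode (pos_code (pos_decode n + b))))) = fst a b)"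
      using \<tau>(1) s[of n] by (intro bexI[of _ "(\<tau>, z (pos_decode n))"]) auto
  qed
  then show thesis by (rule that)
qed

lemma computable_column [computable_intros]:
  "computable k f \<Longrightarrow> computable k (\<lambda>xs. column h (f xs))"
  unfolding column_def by (rule computable_coordinate)

lemma decidable_blocked:
  assumes L: "finite L" "finite B"
    and s: "\<And>a. a \<in> L \<Longrightarrow> decidable (Suc k) (\<lambda>ys. s (snd a) (hd ys) (tl ys))"
  shows "decidable (Suc k) (\<lambda>ys. blocked L B S h (hd ys) (\<lambda>g m. s g m (tl ys)))"
proof -
  have s': "decidable (Suc (Suc (Suc k))) (\<lambda>ws. s (snd a) (column h (hd ws)) (tl (tl (tl ws))))"
    if "a \<in> L" for a
    using decidable_subst[OF s[OF that], of 3 "\<lambda>ws. column h (hd ws)"]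
    by (simp add: drop_Suc numeral_3_eq_3 computable_column computable_hd)
  show ?thesis
    unfolding blocked_def
    by (intro computable_intros decidable_bex_finite decidable_ball_finite L s' computable_translate)
qed

lemma decidable_certified:
  assumes L: "finite L" "finite B" and q: "computable (Suc k) q" "\<And>ys. q ys > 0" and c: "computable (Suc k) c"
    and s: "\<And>a. a \<in> L \<Longrightarrow> decidable (Suc k) (\<lambda>ys. s (snd a) (hd ys) (tl ys))"
  shows "decidable (Suc k) (\<lambda>ys. certified L B S h (q ys) (c ys) (\<lambda>g m. s g m (tl ys)))"
proof -
  have s': "decidable (Suc (Suc k)) (\<lambda>ws. s (snd a) (column h (hd ws)) (tl (tl ws)))"
    if "a \<in> L" for a
    using decidable_subst[OF s[OF that], of 2 "\<lambda>ws. column h (hd ws)"]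
    by (simp add: drop_Suc numeral_2_eq_2 computable_column computable_hd)
  show ?thesis
    unfolding certified_def
    by (intro computable_intros decidable_bex_finite decidable_ball_finite L s' computable_translate
        computable_fold_pos computable_box_bound q computable_tl[OF q(1)] computable_tl[OF c])
qed

section \<open>Words and patterns as numbers\<close>

lemma nth_in_nonempty_words: "u \<in> nonempty_words \<Gamma> \<Longrightarrow> i < length u \<Longrightarrow> u ! i \<in> \<Gamma>"
  by (auto simp: nonempty_words_def)

lemma list_decode_word_code [simp]: "list_decode (word_code e u) = map e u"
  by (simp add: word_code_def)

definition valid_word :: "nat set \<Rightarrow> nat \<Rightarrow> bool" where
  "valid_word E c \<longleftrightarrow> 0 < length (list_decode c) \<and> (\<forall>i<length (list_decode c). code_nth c i \<in> E)"

lemma valid_word_iff: "valid_word (e ` \<Gamma>) c \<longleftrightarrow> (\<exists>u\<in>nonempty_words \<Gamma>. c = word_code e u)"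
proof
  let ?l = "list_decode c"
  assume c: "valid_word (e ` \<Gamma>) c"
  have "\<forall>i<length ?l. ?l ! i \<in> e ` \<Gamma>"
    using c code_nth[of _ ?l] by (simp add: valid_word_def)
  then obtain f where f: "\<And>i. i < length ?l \<Longrightarrow> ?l ! i = e (f i) \<and> f i \<in> \<Gamma>" unfolding image_iff by metis
  let ?u = "map f [0..<length ?l]"
  have "map e ?u = ?l" using f by (intro nth_equalityI) auto
  then have "c = word_code e ?u" by (metis list_decode_inverse word_code_def)
  moreover have "?u \<in> nonempty_words \<Gamma>" using f c by (auto simp: nonempty_words_def valid_word_def)
  ultimately show "\<exists>u\<in>nonempty_words \<Gamma>. c = word_code e u" by blast
next
  assume "\<exists>u\<in>nonempty_words \<Gamma>. c = word_code e u"
  then show "valid_word (e ` \<Gamma>) c"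
    using nth_in_nonempty_words
    by (auto simp: valid_word_def word_code_def code_nth) (auto simp: nonempty_words_def)
qed

lemma decidable_mem_finite [computable_intros]:
  assumes "finite E" "computable k f"
  shows "decidable k (\<lambda>xs. f xs \<in> E)"
proof -
  have "decidable k (\<lambda>xs. \<exists>a\<in>E. f xs = a)"
    by (intro decidable_bex_finite assms computable_intros)
  then show ?thesis by simp
qed

lemma decidable_valid_word [computable_intros]:
  assumes "finite E" "computable k c"
  shows "decidable k (\<lambda>xs. valid_word E (c xs))"
  unfolding valid_word_def by (intro computable_intros assms computable_tl[OF assms(2)])

text \<open>The function \<open>bi_infinite\<close> on codes: \<open>xs\<close> holds the codes of the three words and \<open>m\<close>
  codes an integer, so that odd \<open>m\<close> are the negative positions.\<close>
definition word_symbol :: "nat \<Rightarrow> nat list \<Rightarrow> nat" where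
  "word_symbol m xs =
     (if even m then
        if m div 2 < length (list_decode (hd (tl xs))) then code_nth (hd (tl xs)) (m div 2)
        else code_nth (hd (tl (tl xs)))
          ((m div 2 - length (list_decode (hd (tl xs)))) mod length (list_decode (hd (tl (tl xs)))))
      else code_nth (hd xs) (length (list_decode (hd xs)) - 1 - (m div 2) mod length (list_decode (hd xs))))"

lemma word_symbol:
  assumes "u \<noteq> []" "w \<noteq> []"
  shows "word_symbol (int_encode n) [word_code e u, word_code e v, word_code e w] = e (bi_infinite u v w n)"
proof (cases "n \<ge> 0")
  case True
  let ?k = "(nat n - length v) mod length w"
  have "?k < length w" using assms by simp
  moreover have "nat ((n - int (length v)) mod int (length w)) = ?k" if "\<not> n < int (length v)"
    using that True by (simp add: nat_mod_distrib nat_diff_distrib)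
  ultimately show ?thesis
    using True by (auto simp: word_symbol_def int_encode_nonneg bi_infinite_def word_code_def code_nth)
next
  case False
  let ?b = "nat (- n - 1)" and ?l = "length u"
  have b: "?b mod ?l < ?l" using assms by simp
  have "n mod int ?l = int_decode (2 * (?l - 1 - ?b mod ?l))"
    using mod_code[of ?l "2 * ?b + 1"] assms False by (simp add: int_decode_odd)
  then have "nat (n mod int ?l) = ?l - 1 - ?b mod ?l" by (simp add: int_decode_even)
  then show ?thesis using False b
    by (simp add: word_symbol_def int_encode_neg bi_infinite_def word_code_def code_nth)
qed

lemma bi_infinite_in:
  assumes "u \<in> nonempty_words \<Gamma>" "v \<in> nonempty_words \<Gamma>" "w \<in> nonempty_words \<Gamma>"
  shows "bi_infinite u v w n \<in> \<Gamma>"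
proof -
  have "nat (k mod int (length x)) < length x" if "x \<noteq> []" for k and x :: "'a list"
    using that by (simp add: nat_less_iff)
  then show ?thesis
    using assms nth_in_nonempty_words[OF assms(1)] nth_in_nonempty_words[OF assms(2)] nth_in_nonempty_words[OF assms(3)]
    unfolding bi_infinite_def nonempty_words_def by (auto simp: nat_less_iff)
qed

lemma bi_infinite_same_tail:
  assumes "length u dvd q" "length w dvd q" "length v \<le> q" "same_tail q a b"
  shows "bi_infinite u v w a = bi_infinite u v w b"
proof -
  have *: "a mod int l = b mod int l" if "l dvd q" "int q dvd a - b" for l :: nat and a b
    using that by (metis dvd_trans int_dvd_int_iff mod_eq_dvd_iff)
  show ?thesis
    using assms(4) unfolding same_tail_def
  proof (elim disjE conjE)
    assume ab: "int q \<le> a" "int q \<le> b" "int q dvd a - b"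
    have "(a - int (length v)) mod int (length w) = (b - int (length v)) mod int (length w)"
      using ab(3) by (intro *[OF assms(2)]) simp
    then show ?thesis using ab assms(3) by (simp add: bi_infinite_def)
  next
    assume ab: "a < - int q" "b < - int q" "int q dvd a - b"
    then show ?thesis using *[OF assms(1) ab(3)] by (simp add: bi_infinite_def)
  qed simp
qed

lemma decidable_word_symbol:
  "decidable (Suc 3) (\<lambda>ys. word_symbol (hd ys) (tl ys) = c)"
proof -
  have [computable_intros]: "computable 4 (\<lambda>ys. hd ys)" "computable 4 (\<lambda>ys. hd (tl ys))"
    "computable 4 (\<lambda>ys. hd (tl (tl ys)))" "computable 4 (\<lambda>ys. hd (tl (tl (tl ys))))"
    using computable_hd computable_tl[OF computable_hd] computable_tl[OF computable_tl[OF computable_hd]]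
      computable_tl[OF computable_tl[OF computable_tl[OF computable_hd]]]
    by (simp_all add: eval_nat_numeral)
  show ?thesis unfolding word_symbol_def by simp (intro computable_intros)
qed

text \<open>Recognises the codes of patterns over the alphabet with symbol codes \<open>E\<close>: the coded relation
  has to be functional. The quantifiers are bounded by \<open>m\<close>, as the elements of the set with code
  \<open>m\<close> are smaller than \<open>m\<close>.\<close>
definition valid_pattern :: "nat set \<Rightarrow> nat \<Rightarrow> bool" where
  "valid_pattern E m \<longleftrightarrow> (\<forall>t<m. t \<in> set_decode m \<longrightarrow> snd (prod_decode t) \<in> E \<and>
     (\<forall>t'<m. t' \<in> set_decode m \<longrightarrow> fst (prod_decode t) = fst (prod_decode t') \<longrightarrow> t = t'))"

lemma set_decode_less: "t \<in> set_decode m \<Longrightarrow> t < m"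
proof -
  assume "t \<in> set_decode m"
  then have "2 ^ t \<le> m" by (auto simp: set_decode_def intro: ccontr)
  then show ?thesis using less_exp[of t] by linarith
qed

lemma mem_pattern_code:
  assumes p: "p \<in> patterns \<Gamma>" and e: "inj_on e \<Gamma>" and g: "g \<in> \<Gamma>"
  shows "prod_encode (m, e g) \<in> set_decode (pattern_code e p) \<longleftrightarrow> p (int_decode m) = Some g"
proof -
  have "finite (Map.graph p)" using p by (simp add: patterns_def finite_graph_iff_finite_dom)
  then have "set_decode (pattern_code e p) = (\<lambda>(n, a). prod_encode (int_encode n, e a)) ` Map.graph p"
    unfolding pattern_code_def by simp
  moreover have "prod_encode (m, e g) \<in> (\<lambda>(n, a). prod_encode (int_encode n, e a)) ` Map.graph p
      \<longleftrightarrow> (\<exists>n a. p n = Some a \<and> m = int_encode n \<and> e g = e a)"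
    by (auto simp: Map.graph_def image_iff)
  moreover have "\<dots> \<longleftrightarrow> p (int_decode m) = Some g"
  proof
    assume "\<exists>n a. p n = Some a \<and> m = int_encode n \<and> e g = e a"
    then obtain n a where na: "p n = Some a" "m = int_encode n" "e g = e a" by blast
    then have "a \<in> \<Gamma>" using p by (auto simp: patterns_def ran_def)
    then show "p (int_decode m) = Some g" using na g inj_onD[OF e na(3)] by simp
  next
    assume "p (int_decode m) = Some g"
    then show "\<exists>n a. p n = Some a \<and> m = int_encode n \<and> e g = e a"
      by (intro exI[of _ "int_decode m"] exI[of _ g]) simp
  qed
  ultimately show ?thesis by simp
qed

lemma valid_pattern_iff:
  assumes e: "inj_on e \<Gamma>"
  shows "valid_pattern (e ` \<Gamma>) m \<longleftrightarrow> (\<exists>p\<in>patterns \<Gamma>. m = pattern_code e p)"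
proof
  assume v: "valid_pattern (e ` \<Gamma>) m"
  have v1: "snd (prod_decode t) \<in> e ` \<Gamma>" if "t \<in> set_decode m" for t
    using v that set_decode_less[OF that] unfolding valid_pattern_def by blast
  have v2: "t = t'" if "t \<in> set_decode m" "t' \<in> set_decode m" "fst (prod_decode t) = fst (prod_decode t')" for t t'
    using v that set_decode_less[OF that(1)] set_decode_less[OF that(2)] unfolding valid_pattern_def by blast
  define p where "p = (\<lambda>n. if \<exists>a\<in>\<Gamma>. prod_encode (int_encode n, e a) \<in> set_decode m
     then Some (SOME a. a \<in> \<Gamma> \<and> prod_encode (int_encode n, e a) \<in> set_decode m) else None)"
  have p: "p n = Some a \<longleftrightarrow> a \<in> \<Gamma> \<and> prod_encode (int_encode n, e a) \<in> set_decode m" for n a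
  proof
    assume "p n = Some a"
    then have ex: "\<exists>a. a \<in> \<Gamma> \<and> prod_encode (int_encode n, e a) \<in> set_decode m"
      and a: "a = (SOME a. a \<in> \<Gamma> \<and> prod_encode (int_encode n, e a) \<in> set_decode m)"
      by (auto simp: p_def split: if_splits)
    show "a \<in> \<Gamma> \<and> prod_encode (int_encode n, e a) \<in> set_decode m"
      unfolding a by (rule someI_ex[OF ex])
  next
    assume a: "a \<in> \<Gamma> \<and> prod_encode (int_encode n, e a) \<in> set_decode m"
    have "(SOME a. a \<in> \<Gamma> \<and> prod_encode (int_encode n, e a) \<in> set_decode m) = a"
    proof (rule some_equality)
      show "a \<in> \<Gamma> \<and> prod_encode (int_encode n, e a) \<in> set_decode m" by (rule a)
    next
      fix b assume "b \<in> \<Gamma> \<and> prod_encode (int_encode n, e b) \<in> set_decode m"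
      then have "prod_encode (int_encode n, e b) = prod_encode (int_encode n, e a)" "b \<in> \<Gamma>"
        using v2[of "prod_encode (int_encode n, e b)" "prod_encode (int_encode n, e a)"] a by auto
      then show "b = a" using a inj_onD[OF e] by simp
    qed
    then show "p n = Some a" using a by (auto simp: p_def)
  qed
  have img: "(\<lambda>(n, a). prod_encode (int_encode n, e a)) ` Map.graph p = set_decode m"
  proof (intro equalityI subsetI)
    fix t assume t: "t \<in> set_decode m"
    obtain a where a: "a \<in> \<Gamma>" "snd (prod_decode t) = e a" using v1[OF t] by blast
    have "prod_encode (int_encode (int_decode (fst (prod_decode t))), e a) = t"
      using a(2) by (metis int_decode_inverse prod.collapse prod_decode_inverse)
    then show "t \<in> (\<lambda>(n, a). prod_encode (int_encode n, e a)) ` Map.graph p"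
      using p[of "int_decode (fst (prod_decode t))" a] a(1) t
      by (intro image_eqI[of _ _ "(int_decode (fst (prod_decode t)), a)"]) (auto simp: Map.graph_def)
  qed (auto simp: Map.graph_def p)
  have "inj_on (\<lambda>(n, a). prod_encode (int_encode n, e a)) (Map.graph p)"
    by (auto simp: inj_on_def Map.graph_def p int_encode_eq inj_onD[OF e])
  then have "finite (Map.graph p)" using img finite_imageD[of _ "Map.graph p"] finite_set_decode[of m] by metis
  then have "p \<in> patterns \<Gamma>" using p by (auto simp: patterns_def finite_graph_iff_finite_dom ran_def)
  moreover have "m = pattern_code e p" unfolding pattern_code_def img by simp
  ultimately show "\<exists>p\<in>patterns \<Gamma>. m = pattern_code e p" by blast
next
  assume "\<exists>p\<in>patterns \<Gamma>. m = pattern_code e p"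
  then obtain p where p: "p \<in> patterns \<Gamma>" "m = pattern_code e p" by blast
  have "finite (Map.graph p)" using p by (simp add: patterns_def finite_graph_iff_finite_dom)
  then have "set_decode m = (\<lambda>(n, a). prod_encode (int_encode n, e a)) ` Map.graph p"
    unfolding p(2) pattern_code_def by simp
  then show "valid_pattern (e ` \<Gamma>) m"
    using p(1) unfolding valid_pattern_def
    by (auto simp: Map.graph_def patterns_def ran_def int_encode_eq)
qed

lemma decidable_valid_pattern [computable_intros]:
  assumes "finite E" "computable k m"
  shows "decidable k (\<lambda>xs. valid_pattern E (m xs))"
  unfolding valid_pattern_def
  by (intro computable_intros assms computable_tl[OF assms(2)] computable_tl[OF computable_tl[OF assms(2)]])

section \<open>The countable cover conditions\<close>

lemma blocked_cong:
  assumes "\<And>a n. a \<in> L \<Longrightarrow> n < N \<Longrightarrow> s (snd a) (column h n) \<longleftrightarrow> s' (snd a) (column h n)"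
  shows "blocked L B S h N s \<longleftrightarrow> blocked L B S h N s'"
proof -
  have eq: "(\<exists>a\<in>L. s (snd a) (column h n) \<and> D a) \<longleftrightarrow> (\<exists>a\<in>L. s' (snd a) (column h n) \<and> D a)"
    if "n < N" for n D
    by (rule bex_cong) (use assms that in simp_all)
  show ?thesis
    unfolding blocked_def
    by (intro all_cong ex_cong conj_cong refl arg_cong[where f = Not] eq)
qed

lemma word_code_eq:
  assumes "inj_on e \<Gamma>" "u \<in> nonempty_words \<Gamma>" "u' \<in> nonempty_words \<Gamma>"
  shows "word_code e u = word_code e u' \<longleftrightarrow> u = u'"
proof -
  have "map e u = map e u' \<longleftrightarrow> u = u'"
    using assms by (intro inj_on_map_eq_map) (auto simp: nonempty_words_def intro: inj_on_subset)
  then show ?thesis by (simp add: word_code_def list_encode_eq)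
qed

text \<open>The witnesses that \<open>\<dots> u u v w w \<dots>\<close> belongs or does not belong to the projective
  subdynamics; the environment holds the witness and then the codes of \<open>u\<close>, \<open>v\<close> and \<open>w\<close>. In the
  first case the witness is a pair of \<open>q - 1\<close> and \<open>c\<close>; storing \<open>q - 1\<close> makes \<open>q\<close> positive. The
  conditions on \<open>q\<close> say that the configuration itself respects the folding and
  that the window of the local rule, whose horizontal radius is to be bounded by \<open>R\<close>, fits in.\<close>
lemma decidable_word_certificate:
  assumes "finite \<Gamma>" "finite L" "finite B"
  shows "decidable (Suc 3) (\<lambda>ys. (valid_word (e ` \<Gamma>) (hd (tl ys)) \<and> valid_word (e ` \<Gamma>) (hd (tl (tl ys)))
      \<and> valid_word (e ` \<Gamma>) (hd (tl (tl (tl ys))))) \<and> R \<le> Suc (fst (prod_decode (hd ys)))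
      \<and> Suc (fst (prod_decode (hd ys))) mod length (list_decode (hd (tl ys))) = 0
      \<and> Suc (fst (prod_decode (hd ys))) mod length (list_decode (hd (tl (tl (tl ys))))) = 0
      \<and> length (list_decode (hd (tl (tl ys)))) \<le> Suc (fst (prod_decode (hd ys)))
      \<and> certified L B S h (Suc (fst (prod_decode (hd ys)))) (snd (prod_decode (hd ys)))
          (\<lambda>g m. word_symbol m (tl ys) = e g))" (is ?cert)
    and "decidable (Suc 3) (\<lambda>ys. \<not> (valid_word (e ` \<Gamma>) (hd (tl ys)) \<and> valid_word (e ` \<Gamma>) (hd (tl (tl ys)))
      \<and> valid_word (e ` \<Gamma>) (hd (tl (tl (tl ys)))))
      \<or> blocked L B S h (hd ys) (\<lambda>g m. word_symbol m (tl ys) = e g))" (is ?disproof)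
proof -
  have [computable_intros]: "computable (Suc 3) (\<lambda>ys. hd ys)" "computable (Suc 3) (\<lambda>ys. hd (tl ys))"
    "computable (Suc 3) (\<lambda>ys. hd (tl (tl ys)))" "computable (Suc 3) (\<lambda>ys. hd (tl (tl (tl ys))))"
    using computable_hd computable_tl[OF computable_hd] computable_tl[OF computable_tl[OF computable_hd]]
      computable_tl[OF computable_tl[OF computable_tl[OF computable_hd]]]
    by (simp_all add: eval_nat_numeral)
  have E: "finite (e ` \<Gamma>)" using assms by simp
  show ?cert
    by (intro computable_intros E decidable_certified decidable_word_symbol assms) simp
  show ?disproof
    by (intro computable_intros E decidable_blocked decidable_word_symbol assms)
qed

theorem corollary7:
  fixes \<Gamma> :: "'a set" and Y :: "(int ^ 'd::finite \<Rightarrow> 'a) set" and h :: 'd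
  assumes "CARD('d) \<ge> 2"
    and "finite \<Gamma>"
    and "sofic \<Gamma> Y"
    and "countably_covered \<Gamma> Y"
    and "vertically_constant h Y"
  shows "countable_cover_conditions h \<Gamma> Y"
proof -
  note vert = \<open>vertically_constant h Y\<close>
  obtain A :: "nat set" and X \<phi> where cover: "SFT_cover A X \<Gamma> Y \<phi>" and count: "countable X"
    using assms(4) by (auto simp: countably_covered_def)
  obtain B L where B: "finite B" "0 \<in> B" and L: "finite L"
    and LA: "\<And>\<tau> g b. (\<tau>, g) \<in> L \<Longrightarrow> g \<in> \<Gamma> \<and> (b \<in> B \<longrightarrow> \<tau> b \<in> A)"
    and rule: "\<And>x y. x \<in> X \<and> \<phi> x = y \<longleftrightarrow> (\<forall>v. obeys L B x y v)"
    using SFT_cover_local_rule[OF cover] by metis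
  have Y: "shift_space \<Gamma> Y" "Y = \<phi> ` X" and "finite A"
    using cover by (auto simp: SFT_cover_def block_code_def shift_space_def)
  have LG: "snd a \<in> \<Gamma>" if "a \<in> L" for a using LA[of "fst a" "snd a"] that by simp
  obtain S where S: "S > 0" "\<And>a. a \<in> A \<Longrightarrow> a < S"
    using \<open>finite A\<close> finite_nat_set_iff_bounded[of "insert 0 A"] by auto
  have xS: "x v < S" if ob: "\<And>v. obeys L B x z v" for x v and z :: "int ^ 'd \<Rightarrow> 'a"
  proof -
    obtain a where a: "a \<in> L" "\<forall>b\<in>B. x (v + b) = fst a b"
      using ob[of v] unfolding obeys_def by blast
    then have "x v = fst a 0" using B(2) by force
    then show ?thesis using LA[of "fst a" "snd a" 0] B(2) a(1) S(2) by simp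
  qed
  let ?P = "projective_subdynamics h Y"
  let ?lift = "\<lambda>y (v :: int ^ 'd). y (v $ h)"
  have P_lift: "y \<in> ?P \<longleftrightarrow> ?lift y \<in> Y" for y
  proof
    assume "y \<in> ?P"
    then obtain z where z: "z \<in> Y" "y = (\<lambda>n. z (axis h n))" by (auto simp: projective_subdynamics_def)
    have "?lift y v = z v" for v
      unfolding z(2) by (rule vertically_constant_eq[OF vert z(1)]) (simp add: axis_def)
    then have "?lift y = z" by (rule ext)
    then show "?lift y \<in> Y" using z(1) by metis
  next
    assume "?lift y \<in> Y"
    then show "y \<in> ?P" unfolding projective_subdynamics_def
      by (intro image_eqI[of _ _ "?lift y"]) (auto simp: axis_def)
  qed
  have P_iff: "y \<in> ?P \<longleftrightarrow> (\<exists>x. \<forall>v. obeys L B x (?lift y) v)" for y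
  proof -
    have "z \<in> Y \<longleftrightarrow> (\<exists>x. x \<in> X \<and> \<phi> x = z)" for z unfolding Y(2) image_iff by metis
    then have "?lift y \<in> Y \<longleftrightarrow> (\<exists>x. \<forall>v. obeys L B x (?lift y) v)" by (simp only: rule)
    then show ?thesis by (simp only: P_lift)
  qed
  have P_shift_space: "shift_space \<Gamma> ?P"
    unfolding shift_space_def
  proof (intro conjI allI ballI)
    show "finite \<Gamma>" by (rule assms)
    \<comment> \<open>a continuous image of a compact set in a Hausdorff space\<close>
    have "compactin (full_shift \<Gamma>) Y"
      using Y(1) closedin_compact_space[OF compact_full_shift] by (auto simp: shift_space_def)
    moreover have "continuous_map (full_shift \<Gamma>) (full_shift \<Gamma>) (\<lambda>x n. x (axis h n))"
      unfolding continuous_map_into_full_shift by (simp add: continuous_map_coordinate)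
    ultimately have "compactin (full_shift \<Gamma>) ?P"
      unfolding projective_subdynamics_def by (rule image_compactin)
    then show "closedin (full_shift \<Gamma>) ?P" by (rule compactin_imp_closedin[OF Hausdorff_full_shift])
  next
    fix n y assume "y \<in> ?P"
    then have "shift (axis h n) (?lift y) \<in> Y" using P_lift Y(1) by (auto simp: shift_space_def)
    also have "shift (axis h n) (?lift y) = ?lift (shift n y)"
      by (simp add: shift_def axis_def fun_eq_iff)
    finally show "shift n y \<in> ?P" using P_lift by blast
  qed
  have P_range: "range y \<subseteq> \<Gamma>" if "y \<in> ?P" for y using shift_space_range[OF P_shift_space that] .

  have "effectively_closed \<Gamma> ?P"
    unfolding effectively_closed_def
  proof (intro conjI allI impI P_shift_space)
    fix e :: "'a \<Rightarrow> nat" assume e: "inj_on e \<Gamma>"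
    define F where "F = {p \<in> patterns \<Gamma>. \<exists>N. (\<forall>n<N. int_decode (column h n) \<in> dom p) \<and>
        blocked L B S h N (\<lambda>g m. p (int_decode m) = Some g)}"
    \<comment> \<open>the definition of \<open>F\<close> in terms of codes, in which every ingredient is decidable\<close>
    have code: "pattern_code e ` F = {m. \<exists>N. valid_pattern (e ` \<Gamma>) m \<and>
        (\<forall>n<N. \<exists>g\<in>\<Gamma>. prod_encode (column h n, e g) \<in> set_decode m) \<and>
        blocked L B S h N (\<lambda>g k. prod_encode (k, e g) \<in> set_decode m)}" (is "_ = {m. \<exists>N. ?G N m}")
    proof -
      have iff: "?G N (pattern_code e p) \<longleftrightarrow> (\<forall>n<N. int_decode (column h n) \<in> dom p) \<and>
          blocked L B S h N (\<lambda>g m. p (int_decode m) = Some g)" if p: "p \<in> patterns \<Gamma>" for p N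
      proof -
        have "(\<exists>g\<in>\<Gamma>. prod_encode (m, e g) \<in> set_decode (pattern_code e p)) \<longleftrightarrow> int_decode m \<in> dom p" for m
          using mem_pattern_code[OF p e] p by (auto simp: patterns_def ran_def)
        moreover have "blocked L B S h N (\<lambda>g k. prod_encode (k, e g) \<in> set_decode (pattern_code e p)) \<longleftrightarrow>
            blocked L B S h N (\<lambda>g m. p (int_decode m) = Some g)"
          by (rule blocked_cong) (simp add: mem_pattern_code[OF p e] LG)
        moreover have "valid_pattern (e ` \<Gamma>) (pattern_code e p)" using valid_pattern_iff[OF e] p by blast
        ultimately show ?thesis by simp
      qed
      show ?thesis
      proof (intro equalityI subsetI)
        fix m assume "m \<in> pattern_code e ` F"
        then obtain p N where "m = pattern_code e p" "p \<in> patterns \<Gamma>"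
          "\<forall>n<N. int_decode (column h n) \<in> dom p" "blocked L B S h N (\<lambda>g m. p (int_decode m) = Some g)"
          unfolding F_def by blast
        then show "m \<in> {m. \<exists>N. ?G N m}" using iff by blast
      next
        fix m assume "m \<in> {m. \<exists>N. ?G N m}"
        then obtain N where N: "?G N m" by blast
        then obtain p where p: "p \<in> patterns \<Gamma>" "m = pattern_code e p" using valid_pattern_iff[OF e] by blast
        then have "p \<in> F" using N iff[OF p(1)] unfolding F_def by blast
        then show "m \<in> pattern_code e ` F" using p(2) by blast
      qed
    qed
    have "finite (e ` \<Gamma>)" using assms(2) by simp
    have hds: "computable 2 (\<lambda>ys. hd ys)" "computable 2 (\<lambda>ys. hd (tl ys))"
      using computable_hd computable_tl[OF computable_hd] by (simp_all add: eval_nat_numeral)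
    have d1: "decidable 2 (\<lambda>ys. blocked L B S h (hd ys) (\<lambda>g k. prod_encode (k, e g) \<in> set_decode (hd (tl ys))))"
      using decidable_blocked[OF L B(1), of 1 "\<lambda>g k zs. prod_encode (k, e g) \<in> set_decode (hd zs)" S h] hds
      by (simp add: numeral_2_eq_2 decidable_set_decode computable_prod_encode computable_const)
    have d2: "decidable 2 (\<lambda>ys. \<forall>n<hd ys. \<exists>g\<in>\<Gamma>. prod_encode (column h n, e g) \<in> set_decode (hd (tl ys)))"
      by (intro computable_intros decidable_bex_finite assms(2) hds computable_tl[OF hds(2)])
    have "computably_enumerable (pattern_code e ` F)"
      unfolding code
      by (rule computably_enumerable_ex)
        (intro decidable_conj decidable_valid_pattern \<open>finite (e ` \<Gamma>)\<close> hds d1 d2)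
    moreover have "?P = avoiding \<Gamma> F"
    proof (intro equalityI subsetI)
      fix y assume y: "y \<in> ?P"
      have "\<not> occurs_in p y" if p: "p \<in> F" for p
      proof
        assume "occurs_in p y"
        then obtain t where t: "\<forall>w\<in>dom p. p w = Some (y (t + w))" unfolding occurs_in_def by blast
        have "shift t y \<in> ?P" using P_shift_space y by (simp add: shift_space_def)
        then obtain x where x: "\<And>v. obeys L B x (?lift (shift t y)) v" using P_iff by blast
        obtain N where N: "\<forall>n<N. int_decode (column h n) \<in> dom p"
          "blocked L B S h N (\<lambda>g m. p (int_decode m) = Some g)"
          using p unfolding F_def by blast
        have "\<not> blocked L B S h N (\<lambda>g m. p (int_decode m) = Some g)"
        proof (rule not_blocked_if_obeys[OF x xS[OF x]])
          fix n assume "n < N"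
          then have "int_decode (column h n) \<in> dom p" using N(1) by blast
          then show "p (int_decode (column h n)) = Some (shift t y (pos_decode n $ h))"
            using t by (simp add: shift_def column_def)
        qed
        then show False using N(2) by blast
      qed
      then show "y \<in> avoiding \<Gamma> F" using P_range[OF y] by (simp add: avoiding_def)
    next
      fix y assume y: "y \<in> avoiding \<Gamma> F"
      have nb: "\<not> blocked L B S h N (\<lambda>g m. y (int_decode m) = g)" for N
      proof
        assume b: "blocked L B S h N (\<lambda>g m. y (int_decode m) = g)"
        \<comment> \<open>only the columns of the first \<open>N\<close> places matter, so a finite part of \<open>y\<close> is blocked\<close>
        let ?D = "(\<lambda>n. int_decode (column h n)) ` {..<N}"
        define p where "p = (\<lambda>k. if k \<in> ?D then Some (y k) else None)"
        have dom: "dom p = ?D" by (auto simp: p_def dom_def)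
        have "p \<in> patterns \<Gamma>" using y dom by (auto simp: patterns_def avoiding_def ran_def p_def)
        moreover have "blocked L B S h N (\<lambda>g m. p (int_decode m) = Some g)"
          using b by (rule blocked_cong[THEN iffD1, rotated]) (simp add: p_def)
        ultimately have "p \<in> F" unfolding F_def using dom by auto
        moreover have "occurs_in p y" unfolding occurs_in_def dom by (intro exI[of _ 0]) (simp add: p_def)
        ultimately show False using y by (auto simp: avoiding_def)
      qed
      obtain x where "\<And>v. obeys L B x (?lift y) v"
        by (rule obeys_if_never_blocked[OF B(1) S(1) nb, of "?lift y"]) (auto simp: column_def)
      then show "y \<in> ?P" using P_iff by blast
    qed
    moreover have "F \<subseteq> patterns \<Gamma>" by (auto simp: F_def)
    ultimately show "\<exists>F\<subseteq>patterns \<Gamma>. computably_enumerable (pattern_code e ` F) \<and> ?P = avoiding \<Gamma> F" by blast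
  qed
  moreover have "ultimately_periodic_left y \<and> ultimately_periodic_right y" if "y \<in> ?P" for y
    using image_ultimately_periodic[OF cover count vert, of "?lift y"] P_lift[of y] that
    by (simp add: axis_def)
  moreover have "decidable_relation 3 {[word_code e u, word_code e v, word_code e w] | u v w.
             u \<in> nonempty_words \<Gamma> \<and> v \<in> nonempty_words \<Gamma> \<and> w \<in> nonempty_words \<Gamma> \<and>
             bi_infinite u v w \<in> ?P}" (is "decidable_relation 3 ?W") if e: "inj_on e \<Gamma>" for e
  proof -
    obtain r where r: "r \<ge> 0" "\<And>b. b \<in> B \<Longrightarrow> \<bar>b $ h\<bar> \<le> r"
      using finite_coordinate_bound[OF B(1), of h] by blast
    \<comment> \<open>positive, as it is used as a factor of a divisor of \<open>q\<close>\<close>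
    define R where "R = Suc (nat r)"
    let ?valid = "\<lambda>xs. valid_word (e ` \<Gamma>) (hd xs) \<and> valid_word (e ` \<Gamma>) (hd (tl xs))
      \<and> valid_word (e ` \<Gamma>) (hd (tl (tl xs)))"
    let ?s = "\<lambda>xs g m. word_symbol m xs = e g"
    let ?cert = "\<lambda>n xs. ?valid xs \<and> R \<le> Suc (fst (prod_decode n))
      \<and> Suc (fst (prod_decode n)) mod length (list_decode (hd xs)) = 0
      \<and> Suc (fst (prod_decode n)) mod length (list_decode (hd (tl (tl xs)))) = 0
      \<and> length (list_decode (hd (tl xs))) \<le> Suc (fst (prod_decode n))
      \<and> certified L B S h (Suc (fst (prod_decode n))) (snd (prod_decode n)) (?s xs)"
    let ?disproof = "\<lambda>N xs. \<not> ?valid xs \<or> blocked L B S h N (?s xs)"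
    have correct: "(xs \<in> ?W \<longleftrightarrow> (\<exists>n. ?cert n xs)) \<and> (xs \<notin> ?W \<longleftrightarrow> (\<exists>n. ?disproof n xs))"
      if len: "length xs = 3" for xs
    proof (cases "?valid xs")
      case False
      have "?valid xs" if "xs \<in> ?W" using that valid_word_iff[of e \<Gamma>] by auto
      then show ?thesis using False by blast
    next
      case True
      obtain c1 c2 c3 where "xs = [c1, c2, c3]" using len by (auto simp: length_Suc_conv eval_nat_numeral)
      with True obtain u v w where uvw: "u \<in> nonempty_words \<Gamma>" "v \<in> nonempty_words \<Gamma>" "w \<in> nonempty_words \<Gamma>"
        and xs: "xs = [word_code e u, word_code e v, word_code e w]"
        by (auto simp: valid_word_iff)
      let ?y = "bi_infinite u v w"
      have ne: "u \<noteq> []" "v \<noteq> []" "w \<noteq> []" using uvw by (auto simp: nonempty_words_def)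
      have W: "xs \<in> ?W \<longleftrightarrow> ?y \<in> ?P"
        using uvw word_code_eq[OF e] unfolding xs by fastforce
      have y_in: "?y n \<in> \<Gamma>" for n using uvw by (rule bi_infinite_in)
      have sym: "?s xs (?y (int_decode m)) m" for m
        using word_symbol[of u w "int_decode m" e v] ne unfolding xs by simp
      have sym': "?y (int_decode m) = g" if "?s xs g m" "g \<in> \<Gamma>" for g m
        using sym[of m] that inj_onD[OF e _ y_in that(2)] by metis
      have symC: "?s xs (?lift ?y (pos_decode n)) (column h n)" for n
        using sym[of "column h n"] by (simp add: column_def)
      have symL: "?lift ?y (pos_decode n) = snd a" if "a \<in> L" "?s xs (snd a) (column h n)" for a n
        using sym'[OF that(2) LG[OF that(1)]] by (simp add: column_def)
      have "?y \<in> ?P \<longleftrightarrow> (\<exists>n. ?cert n xs)"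
      proof
        assume "?y \<in> ?P"
        then have z: "?lift ?y \<in> Y" using P_lift by blast
        \<comment> \<open>a divisor of \<open>q\<close> that makes \<open>q\<close> satisfy all conditions in the certificate\<close>
        have "R * length u * length w * length v > 0" using ne by (simp add: R_def)
        then obtain x q where x: "x \<in> X" "\<phi> x = ?lift ?y" "q > 0" "R * length u * length w * length v dvd q"
          and inv: "fold_invariant h q x"
          using fold_invariant_preimage[OF cover count vert z] by metis
        have ob: "obeys L B x (?lift ?y) v" for v using rule x by blast
        have dvd: "R dvd q" "length u dvd q" "length w dvd q" "length v dvd q"
          using x(4) by (auto elim!: dvd_trans[rotated])
        obtain c where c: "certified L B S h q c (?s xs)"
          using certified_if_obeys[OF ob xS[OF ob] inv x(3) B(1), of "?s xs"] symC by blast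
        have "?cert (prod_encode (q - 1, c)) xs"
          using c x(3) dvd True dvd_imp_le[OF dvd(1)] dvd_imp_le[OF dvd(4)] unfolding xs
          by (simp add: dvd_imp_mod_0)
        then show "\<exists>n. ?cert n xs" by (rule exI)
      next
        assume "\<exists>n. ?cert n xs"
        then obtain n where n: "?cert n xs" ..
        define q where "q = Suc (fst (prod_decode n))"
        have q: "q > 0" "R \<le> q" "length u dvd q" "length w dvd q" "length v \<le> q"
          and c: "certified L B S h q (snd (prod_decode n)) (?s xs)"
          using n unfolding q_def[symmetric] by (simp_all add: xs q_def[symmetric] dvd_eq_mod_eq_0) (simp add: q_def)
        have inv: "fold_invariant h q (?lift ?y)"
          unfolding fold_invariant_def using bi_infinite_same_tail[OF q(3,4,5)] by blast
        have bq: "\<bar>b $ h\<bar> \<le> int q" if "b \<in> B" for b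
          using r(2)[OF that] q(2) by (simp add: R_def)
        obtain x where "\<And>v. obeys L B x (?lift ?y) v"
          using obeys_if_certified[OF q(1) bq inv symL c] by blast
        then show "?y \<in> ?P" using P_iff by blast
      qed
      moreover have "?y \<notin> ?P \<longleftrightarrow> (\<exists>n. ?disproof n xs)"
      proof
        assume "?y \<notin> ?P"
        show "\<exists>n. ?disproof n xs"
        proof (rule ccontr)
          assume "\<nexists>n. ?disproof n xs"
          then have nb: "\<not> blocked L B S h N (?s xs)" for N by blast
          obtain x where "\<And>v. obeys L B x (?lift ?y) v"
            by (rule obeys_if_never_blocked[OF B(1) S(1) nb, of "?lift ?y"]) (blast intro: symL)+
          then show False using P_iff \<open>?y \<notin> ?P\<close> by blast
        qed
      next
        assume "\<exists>n. ?disproof n xs"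
        then obtain N where N: "blocked L B S h N (?s xs)" using True by blast
        show "?y \<notin> ?P"
        proof
          assume "?y \<in> ?P"
          then obtain x where x: "\<And>v. obeys L B x (?lift ?y) v" using P_iff by blast
          have "\<not> blocked L B S h N (?s xs)"
            by (rule not_blocked_if_obeys[OF x xS[OF x]]) (rule symC)
          then show False using N by blast
        qed
      qed
      ultimately show ?thesis unfolding W by (rule conjI)
    qed
    have "decidable 3 (\<lambda>xs. xs \<in> ?W)"
    proof (rule decidable_by_witnesses[of 3 ?cert ?disproof])
      show "decidable (Suc 3) (\<lambda>ys. ?cert (hd ys) (tl ys))"
        by (rule decidable_word_certificate(1)[OF assms(2) L B(1)])
      show "decidable (Suc 3) (\<lambda>ys. ?disproof (hd ys) (tl ys))"
        by (rule decidable_word_certificate(2)[OF assms(2) L B(1)])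
    next
      fix xs :: "nat list" assume len: "length xs = 3"
      show "xs \<in> ?W \<longleftrightarrow> (\<exists>n. ?cert n xs)" using correct[OF len] by (rule conjunct1)
      show "xs \<notin> ?W \<longleftrightarrow> (\<exists>n. ?disproof n xs)" using correct[OF len] by (rule conjunct2)
    qed
    then show ?thesis
      unfolding decidable_def computable_def decidable_relation_def of_bool_def .
  qed
  ultimately show ?thesis
    unfolding countable_cover_conditions_def countable_cover_conditions_1_def
    using Y(1) vert P_shift_space by blast
qed

end
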